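(* Let $p=p(n)$, $d=p(n-1)$, and suppose that $\log n\ll d=o(n)$. Let $i\ge1$ be the largest integer such that $d^i=o(n)$, let $c=c(n)=d^{i+1}/n$, and let $\eta=\log_n d^i$. Suppose that $c-2\log n\to\infty$. Let $G=(V,E)\in G(n,p)$. Then a.a.s. $$\beta(G)\ge(\eta+o(1))\frac{n\log n}{d^i}.$$
   Context: For a finite connected graph $G=(V,E)$ and $R=\{r_1,\dots,r_k\}\subseteq V$, $d_R(v)$ is the vector of graph distances from $v$ to $r_1,\dots,r_k$; $R$ is resolving if $d_R(v)\ne d_R(w)$ for all distinct $v,w$; the metric dimension $\beta(G)$ is the minimum size of a resolving set. $G(n,p)$ is the binomial random graph on $\{1,\dots,n\}$ with each pair an edge independently with probability $p=p(n)$. Asymptotics are as $n\to\infty$; a.a.s. means with probability tending to $1$; $f\ll g$ means $f=o(g)$. $\log$ is the natural logarithm and $\log_n x=\log x/\log n$. *)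

theory Defs
  imports
    "HOL-Probability.Probability"
    "HOL-Probability.Product_PMF"
    "HOL-Library.Landau_Symbols"
    "Graph_Theory.Graph_Theory"
begin

text \<open>
  Undirected graphs are symmetric digraphs, as in the library (locales \<^locale>\<open>graph\<close> and
  \<^locale>\<open>pair_graph\<close>). The graph distance is the shortest-path weight for unit arc weights.
\<close>

definition graph_dist :: "('a, 'b) pre_digraph \<Rightarrow> 'a \<Rightarrow> 'a \<Rightarrow> ereal" where
  "graph_dist G u v = wf_digraph.\<mu> G (\<lambda>_. 1) u v"

text \<open>The vector of distances from \<open>v\<close>, indexed by the elements of \<open>R\<close> themselves.\<close>

definition dist_vec :: "('a, 'b) pre_digraph \<Rightarrow> 'a set \<Rightarrow> 'a \<Rightarrow> 'a \<Rightarrow> ereal" where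
  "dist_vec G R v = (\<lambda>r\<in>R. graph_dist G v r)"

definition resolving :: "('a, 'b) pre_digraph \<Rightarrow> 'a set \<Rightarrow> bool" where
  "resolving G R \<longleftrightarrow> R \<subseteq> verts G \<and>
     (\<forall>v\<in>verts G. \<forall>w\<in>verts G. v \<noteq> w \<longrightarrow> dist_vec G R v \<noteq> dist_vec G R w)"

text \<open>
  Intended for finite connected graphs. The minimum exists, since \<^term>\<open>verts G\<close> is resolving.
\<close>

definition metric_dim :: "('a, 'b) pre_digraph \<Rightarrow> nat" where
  "metric_dim G = (LEAST k. \<exists>R. resolving G R \<and> card R = k)"

definition vertex_pairs :: "nat \<Rightarrow> nat set set" where
  "vertex_pairs n = {e. e \<subseteq> {1..n} \<and> card e = 2}"

definition graph_of_edges :: "nat \<Rightarrow> nat set set \<Rightarrow> nat pair_pre_digraph" where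
  "graph_of_edges n E = \<lparr>pverts = {1..n}, parcs = {(u, v). {u, v} \<in> E}\<rparr>"

text \<open>
  The binomial random graph. Each edge indicator is an independent Bernoulli variable; since
  \<^const>\<open>bernoulli_pmf\<close> clips its parameter, this is meaningful only for \<open>0 \<le> p \<le> 1\<close>.
\<close>

definition gnp :: "nat \<Rightarrow> real \<Rightarrow> nat pair_pre_digraph pmf" where
  "gnp n p =
     map_pmf (\<lambda>f. graph_of_edges n {e \<in> vertex_pairs n. f e})
       (Pi_pmf (vertex_pairs n) False (\<lambda>_. bernoulli_pmf p))"

lemma pair_graph_gnp:
  assumes "G \<in> set_pmf (gnp n p)"
  shows "pair_graph G"
proof -
  obtain E where E: "E \<subseteq> vertex_pairs n" and G: "G = graph_of_edges n E"
  proof -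
    from assms obtain f where "G = graph_of_edges n {e \<in> vertex_pairs n. f e}"
      by (auto simp: gnp_def)
    then show thesis by (intro that) auto
  qed
  have sub: "u \<in> {1..n} \<and> v \<in> {1..n} \<and> u \<noteq> v" if "{u, v} \<in> E" for u v
  proof -
    have "{u, v} \<subseteq> {1..n}" "card {u, v} = 2"
      using that E unfolding vertex_pairs_def by blast+
    then show ?thesis by auto
  qed
  have fin: "finite {(u, v). {u, v} \<in> E}"
    by (rule finite_subset[of _ "{1..n} \<times> {1..n}"]) (use sub in auto)
  show ?thesis
    unfolding G graph_of_edges_def
    by unfold_locales
      (use sub fin in \<open>fastforce simp: symmetric_def sym_def insert_commute\<close>)+
qed

lemma resolving_verts:
  assumes "wf_digraph G"
  shows "resolving G (verts G)"
proof -
  interpret wf_digraph G by fact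
  have nonneg: "0 \<le> awalk_cost (\<lambda>_. 1) p" if "awalk u p v" for u v p
    using pos_cost_pos_awalk_cost[OF that] by simp
  have zero: "graph_dist G v v = 0" if "v \<in> verts G" for v
  proof (rule antisym)
    have "awalk v [] v" using that by (simp add: awalk_Nil_iff)
    from min_cost_le_walk_cost[OF this, of "\<lambda>_. 1"]
    show "graph_dist G v v \<le> 0" by (simp add: graph_dist_def zero_ereal_def)
    show "0 \<le> graph_dist G v v"
      unfolding graph_dist_def \<mu>_def by (rule INF_greatest) (auto intro: nonneg)
  qed
  have pos: "1 \<le> graph_dist G v w" if "v \<noteq> w" for v w
    unfolding graph_dist_def \<mu>_def
  proof (rule INF_greatest)
    fix p assume "p \<in> {p. awalk v p w}"
    then have p: "awalk v p w" by simp
    with that obtain e q where "p = e # q" by (cases p) (auto simp: awalk_Nil_iff)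
    with p have "awalk (head G e) q w" by (simp add: awalk_Cons_iff)
    from nonneg[OF this] \<open>p = e # q\<close> show "1 \<le> ereal (awalk_cost (\<lambda>_. 1) p)"
      by (simp add: one_ereal_def)
  qed
  show ?thesis
    unfolding resolving_def
  proof (intro conjI ballI impI notI)
    fix v w assume vw: "v \<in> verts G" "w \<in> verts G" "v \<noteq> w"
      and eq: "dist_vec G (verts G) v = dist_vec G (verts G) w"
    from fun_cong[OF eq, of w] vw have "graph_dist G v w = graph_dist G w w"
      by (simp add: dist_vec_def)
    with zero[of w] pos[of v w] vw show False by simp
  qed simp
qed

end

theory Submission
  imports Defs "HOL-Real_Asymp.Real_Asymp"
begin

text \<open>
  Fix a set \<open>R\<close> of \<open>r\<close> vertices, \<open>r\<close> slightly below \<open>\<eta> n log n / d ^ i\<close>. Exposing the graph by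
  breadth-first search from \<open>R\<close>, the pair (size of the frontier, number of unexplored vertices) is a
  Markov chain with binomial steps. Its moment generating function, iterated through all levels so
  that no constant factor is lost per level, shows that the \<open>(i - 1)\<close>-ball of \<open>R\<close> has at most
  \<open>(1 + o(1)) r d ^ (i - 1)\<close> vertices; since \<open>log n\<close> is small compared to \<open>d\<close>, the error probability
  beats the number of choices for \<open>R\<close>. The next step then leaves at least \<open>n ^ (1 - \<eta> + \<epsilon>)\<close> vertices
  outside the \<open>i\<close>-ball, again uniformly in \<open>R\<close>.

  Instead of the sharp diameter theorem it suffices that few pairs are at distance larger than
  \<open>i + 1\<close>: the lower tail of the exploration from one vertex bounds the expected number of such pairs
  by \<open>n ^ 2 exp (- (1 - o(1)) c) \<le> n ^ o(1)\<close>. Hence two of the vertices outside the \<open>i\<close>-ball of \<open>R\<close> are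
  at distance exactly \<open>i + 1\<close> from all of \<open>R\<close>, and \<open>R\<close> is not resolving.
\<close>


section \<open>Breadth-first exploration and resolving sets\<close>

text \<open>The number \<open>i\<close> of levels depends on \<open>n\<close> and may be unbounded,
  so a constant lost per level would be fatal. Moreover the union bound runs over up to
  \<open>n ^ r\<close> sets \<open>R\<close>, so each may fail with probability of order
  \<open>n ^ - (r + 1)\<close> only. All estimates are therefore made for a fixed loss
  \<open>a\<close> in \<open>(0, 1]\<close> with explicit constants, and \<open>a\<close> is sent to
  0 along a diagonal sequence at the very end. Powers of \<open>n\<close> with small multiples of
  \<open>a\<close> separate the quantities: the far pairs number at most
  \<open>2 n ^ (a / 32)\<close> in expectation, and Markov's inequality is applied at
  \<open>n ^ (a / 8)\<close>; the vertices missed by \<open>R\<close> have conditional mean at least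
  \<open>(n / d ^ i) n ^ (a / 4) / 2\<close>, whereas the logarithm of the number of choices of
  \<open>R\<close> is at most \<open>(n / d ^ i) (ln n) ^ 2\<close>. The gap between the last two
  pays for the union bound.\<close>

definition discovered :: "('a set \<Rightarrow> bool) \<Rightarrow> 'a set \<Rightarrow> 'a set \<Rightarrow> 'a set" where
  "discovered f S U = {u \<in> U. \<exists>s\<in>S. f {s, u}}"

text \<open>A vertex leaves the state once it has been expanded. Hence no pair is queried twice,
  which is what makes the sizes of the two remaining sets a Markov chain.\<close>

fun bfs :: "nat \<Rightarrow> ('a set \<Rightarrow> bool) \<Rightarrow> 'a set \<Rightarrow> 'a set \<Rightarrow> 'a set \<times> 'a set" where
  "bfs 0 f S U = (S, U)"
| "bfs (Suc k) f S U = bfs k f (discovered f S U) (U - discovered f S U)"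

definition unreached :: "nat \<Rightarrow> ('a set \<Rightarrow> bool) \<Rightarrow> 'a set \<Rightarrow> 'a set \<Rightarrow> 'a set" where
  "unreached k f S U = snd (bfs k f S U)"

lemma discovered_subset: "discovered f S U \<subseteq> U"
  by (auto simp: discovered_def)

lemma unreached_simps [simp]:
  "unreached 0 f S U = U"
  "unreached (Suc k) f S U = unreached k f (discovered f S U) (U - discovered f S U)"
  by (auto simp: unreached_def)

lemma unreached_subset: "unreached k f S U \<subseteq> U"
proof (induction k arbitrary: S U)
  case (Suc k)
  then show ?case by fastforce
qed simp

text \<open>If \<open>w\<close> were in \<open>S\<close>, the first level would already discover
  \<open>v\<close>. So \<open>w\<close> passes to the next frontier or stays unexplored, and the
  induction continues there: one edge lowers the level by at most one.\<close>

lemma neighbour_of_unreached: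
  assumes "v \<in> unreached (Suc k) f S U" "f {v, w}" "w \<in> S \<union> U"
  shows "w \<in> unreached k f S U"
  using assms
proof (induction k arbitrary: S U)
  case 0
  then show ?case by (auto simp: discovered_def insert_commute)
next
  case (Suc k)
  have "v \<in> U - discovered f S U"
    using Suc.prems(1) unreached_subset by fastforce
  then have "w \<notin> S"
    using Suc.prems(2) by (auto simp: discovered_def insert_commute)
  then have "w \<in> discovered f S U \<union> (U - discovered f S U)"
    using Suc.prems(3) by auto
  then have "w \<in> unreached k f (discovered f S U) (U - discovered f S U)"
    using Suc.prems by (intro Suc.IH) simp_all
  then show ?case by simp
qed

abbreviation edge_graph :: "nat \<Rightarrow> (nat set \<Rightarrow> bool) \<Rightarrow> nat pair_pre_digraph" where
  "edge_graph n f \<equiv> graph_of_edges n {e \<in> vertex_pairs n. f e}"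

lemma pverts_edge_graph [simp]: "pverts (edge_graph n f) = {1..n}"
  by (simp add: graph_of_edges_def)

lemma doubleton_in_vertex_pairs:
  "{u, v} \<in> vertex_pairs n \<longleftrightarrow> u \<in> {1..n} \<and> v \<in> {1..n} \<and> u \<noteq> v"
  by (auto simp: vertex_pairs_def card_insert_if)

lemma parcs_edge_graph [simp]:
  "parcs (edge_graph n f) = {(u, v). u \<in> {1..n} \<and> v \<in> {1..n} \<and> u \<noteq> v \<and> f {u, v}}"
  by (auto simp: graph_of_edges_def doubleton_in_vertex_pairs)

lemma pair_graph_edge_graph: "pair_graph (edge_graph n f)"
proof -
  have "sym (parcs (edge_graph n f))"
    by (auto simp: sym_def insert_commute)
  moreover have "finite (parcs (edge_graph n f))"
    by (rule finite_subset[of _ "{1..n} \<times> {1..n}"]) auto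
  ultimately show ?thesis
    by unfold_locales (auto simp: symmetric_def)
qed

section \<open>Graph distance versus exploration level\<close>

lemma (in wf_digraph) awalk_cost_unit [simp]: "awalk_cost (\<lambda>_. 1) p = real (length p)"
  by (induction p) simp_all

lemma graph_dist_le:
  assumes "wf_digraph G" "pre_digraph.awalk G u p v"
  shows "graph_dist G u v \<le> real (length p)"
  unfolding graph_dist_def
  using wf_digraph.min_cost_le_walk_cost[OF assms, of "\<lambda>_. 1"]
    wf_digraph.awalk_cost_unit[OF assms(1)] by simp

lemma graph_dist_ge:
  assumes "wf_digraph G" "\<And>p. pre_digraph.awalk G u p v \<Longrightarrow> k \<le> length p"
  shows "real k \<le> graph_dist G u v"
  unfolding graph_dist_def wf_digraph.\<mu>_def[OF assms(1)]
  by (rule INF_greatest) (use assms(2) wf_digraph.awalk_cost_unit[OF assms(1)] in auto)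

text \<open>Each arc of a walk uses up at most one level, so a walk of length at most
  \<open>k\<close> starting at \<open>w\<close> ends among vertices that are still unreached at some
  level, and these avoid \<open>R\<close>.\<close>

lemma graph_dist_ge_of_unreached:
  assumes w: "w \<in> unreached k f R ({1..n} - R)" and r: "r \<in> R" "R \<subseteq> {1..n}"
  shows "real (Suc k) \<le> graph_dist (with_proj (edge_graph n f)) w r"
proof -
  interpret pair_graph "edge_graph n f" by (rule pair_graph_edge_graph)
  have walk: "\<lbrakk>awalk v p u; v \<in> unreached j f R ({1..n} - R); length p \<le> j\<rbrakk>
      \<Longrightarrow> u \<in> unreached (j - length p) f R ({1..n} - R)" for p v u j
  proof (induction p arbitrary: v j)
    case Nil
    then show ?case by (auto simp: awalk_Nil_iff)
  next
    case (Cons e p)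
    then obtain x where e: "e = (v, x)" and x: "f {v, x}" "x \<in> {1..n}" "awalk x p u"
      by (cases e) (auto simp: awalk_Cons_iff)
    obtain j' where j: "j = Suc j'" using Cons.prems(3) by (cases j) auto
    have "x \<in> unreached j' f R ({1..n} - R)"
      using neighbour_of_unreached[of v j' f R "{1..n} - R" x] Cons.prems(2) x j by auto
    from Cons.IH[OF x(3) this] Cons.prems(3) j show ?case by auto
  qed
  show ?thesis
  proof (rule graph_dist_ge)
    fix p assume p: "awalk w p r"
    show "Suc k \<le> length p"
    proof (rule ccontr)
      assume "\<not> Suc k \<le> length p"
      then have "r \<in> unreached (k - length p) f R ({1..n} - R)"
        using walk[OF p w] by simp
      moreover have "r \<notin> {1..n} - R" using r(1) by simp
      ultimately show False
        using unreached_subset[of "k - length p" f R "{1..n} - R"] by (meson subsetD)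
    qed
  qed unfold_locales
qed

text \<open>A discovered vertex has a neighbour in the frontier that discovered it; following these
  back gives a walk with at most one arc per level. The inner claim ranges over all disjoint
  \<open>S\<close> and \<open>U\<close> because the recursion replaces both.\<close>

lemma graph_dist_le_of_not_unreached:
  assumes u: "u \<in> {1..n}" and w: "w \<in> {1..n}" "w \<notin> unreached k f {u} ({1..n} - {u})"
  shows "graph_dist (with_proj (edge_graph n f)) w u \<le> real k"
proof -
  interpret pair_graph "edge_graph n f" by (rule pair_graph_edge_graph)
  have walk: "\<lbrakk>S \<subseteq> {1..n}; U \<subseteq> {1..n}; S \<inter> U = {}; v \<in> S \<union> U; v \<notin> unreached j f S U\<rbrakk>
      \<Longrightarrow> \<exists>s\<in>S. \<exists>p. awalk v p s \<and> length p \<le> j" for S U v j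
  proof (induction j arbitrary: S U)
    case 0
    then have "v \<in> S" "v \<in> {1..n}" by auto
    then show ?case by (intro bexI[of _ v] exI[of _ "[]"]) (auto simp: awalk_Nil_iff)
  next
    case (Suc j)
    let ?T = "discovered f S U"
    show ?case
    proof (cases "v \<in> S")
      case True
      then show ?thesis using Suc.prems
        by (intro bexI[of _ v] exI[of _ "[]"]) (auto simp: awalk_Nil_iff)
    next
      case False
      have "\<exists>t\<in>?T. \<exists>p. awalk v p t \<and> length p \<le> j"
        by (rule Suc.IH[of ?T "U - ?T"]) (use Suc.prems False in \<open>auto simp: discovered_def\<close>)
      then obtain t p where t: "t \<in> ?T" and p: "awalk v p t" "length p \<le> j" by auto
      obtain s where s: "s \<in> S" "f {s, t}" using t by (auto simp: discovered_def)
      have "t \<in> U" "t \<noteq> s" using t Suc.prems(3) s by (auto simp: discovered_def)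
      then have "awalk t [(t, s)] s"
        using Suc.prems(1,2) s by (auto simp: awalk_Cons_iff awalk_Nil_iff insert_commute)
      then have "awalk v (p @ [(t, s)]) s"
        using p(1) by (rule awalk_appendI[rotated])
      then show ?thesis using p(2) s(1) by (intro bexI[of _ s] exI[of _ "p @ [(t, s)]"]) auto
    qed
  qed
  obtain p where p: "awalk w p u" "length p \<le> k"
    using walk[of "{u}" "{1..n} - {u}" w k] u w by auto
  have "graph_dist (with_proj (edge_graph n f)) w u \<le> real (length p)"
    by (rule graph_dist_le[OF _ p(1)]) unfold_locales
  also have "\<dots> \<le> real k" using p(2) by simp
  finally show ?thesis .
qed

text \<open>
  Two vertices outside the \<open>k\<close>-ball of \<open>R\<close> that lie in the \<open>k + 1\<close>-ball of every vertex
  have constant distance vector \<open>k + 1\<close>.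
\<close>
lemma not_resolving_of_unreached:
  assumes R: "R \<subseteq> {1..n}"
    and many: "(\<Sum>u\<in>{1..n}. card (unreached (Suc k) f {u} ({1..n} - {u}))) + 2
                 \<le> card (unreached k f R ({1..n} - R))"
  shows "\<not> resolving (with_proj (edge_graph n f)) R"
proof
  assume res: "resolving (with_proj (edge_graph n f)) R"
  let ?far = "\<lambda>u. unreached (Suc k) f {u} ({1..n} - {u})"
  let ?W = "unreached k f R ({1..n} - R)"
  let ?B = "\<Union>u\<in>{1..n}. ?far u"
  have fin: "finite (?far u)" "finite ?W" for u
    by (rule finite_subset[OF unreached_subset], simp)+
  have "card ?B \<le> (\<Sum>u\<in>{1..n}. card (?far u))"
    by (rule card_UN_le) simp
  then have "2 \<le> card (?W - ?B)"
    using many diff_card_le_card_Diff[of ?B ?W] fin by fastforce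
  then obtain v w where vw: "v \<in> ?W - ?B" "w \<in> ?W - ?B" "v \<noteq> w"
    by (auto simp: numeral_2_eq_2 card_le_Suc_iff)
  have dist: "graph_dist (with_proj (edge_graph n f)) x r = real (Suc k)"
    if x: "x \<in> ?W - ?B" and r: "r \<in> R" for x r
  proof (rule antisym)
    have "x \<in> {1..n}" using x unreached_subset[of k f R "{1..n} - R"] by auto
    moreover have "x \<notin> ?far r" using x r R by auto
    ultimately show "graph_dist (with_proj (edge_graph n f)) x r \<le> real (Suc k)"
      using r R by (intro graph_dist_le_of_not_unreached) auto
    show "real (Suc k) \<le> graph_dist (with_proj (edge_graph n f)) x r"
      using x r R by (intro graph_dist_ge_of_unreached) auto
  qed
  have "v \<in> {1..n}" "w \<in> {1..n}"
    using vw unreached_subset[of k f R "{1..n} - R"] by auto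
  moreover have "dist_vec (with_proj (edge_graph n f)) R v
      = dist_vec (with_proj (edge_graph n f)) R w"
    unfolding dist_vec_def using dist vw by (intro restrict_ext) simp
  ultimately show False using res vw(3) by (auto simp: resolving_def)
qed

section \<open>From resolving sets of one size to the metric dimension, and connectivity\<close>

lemma resolving_mono:
  assumes "resolving G R" "R \<subseteq> R'" "R' \<subseteq> verts G"
  shows "resolving G R'"
  unfolding resolving_def
proof (intro conjI ballI impI notI)
  fix v w assume vw: "v \<in> verts G" "w \<in> verts G" "v \<noteq> w" "dist_vec G R' v = dist_vec G R' w"
  have "restrict (dist_vec G R' x) R = dist_vec G R x" for x
    using assms(2) by (auto simp: dist_vec_def restrict_def fun_eq_iff)
  then have "dist_vec G R v = dist_vec G R w" using vw(4) by metis
  then show False using assms(1) vw by (auto simp: resolving_def)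
qed fact

text \<open>A smaller resolving set can be padded to exactly \<open>r\<close> vertices and stays
  resolving, so the union bound needs only one cardinality.\<close>

lemma metric_dim_gt:
  assumes "r \<le> n"
    and no_res: "\<And>R. R \<subseteq> {1..n} \<Longrightarrow> card R = r \<Longrightarrow> \<not> resolving (with_proj (edge_graph n f)) R"
  shows "r < metric_dim (with_proj (edge_graph n f))"
proof (rule ccontr)
  assume "\<not> ?thesis"
  then have le: "metric_dim (with_proj (edge_graph n f)) \<le> r" by simp
  interpret pair_graph "edge_graph n f" by (rule pair_graph_edge_graph)
  have "wf_digraph (with_proj (edge_graph n f))" by unfold_locales
  then have "\<exists>k R. resolving (with_proj (edge_graph n f)) R \<and> card R = k"
    using resolving_verts by blast
  from LeastI_ex[OF this] obtain R where R: "resolving (with_proj (edge_graph n f)) R"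
      "card R = metric_dim (with_proj (edge_graph n f))"
    unfolding metric_dim_def by blast
  have sub: "R \<subseteq> {1..n}" using R(1) by (simp add: resolving_def)
  obtain R' where R': "R \<subseteq> R'" "R' \<subseteq> {1..n}" "card R' = r"
    using exists_subset_between[of R r "{1..n}"] R(2) sub le assms(1) by auto
  then show False using no_res[OF R'(2,3)] resolving_mono[OF R(1) R'(1)] by simp
qed

text \<open>No edge leaves the component of a vertex, and this component or its complement has at
  most \<open>n / 2\<close> vertices.\<close>

lemma connected_edge_graph:
  assumes n: "n \<ge> 1"
    and cut: "\<And>S. S \<subseteq> {1..n} \<Longrightarrow> S \<noteq> {} \<Longrightarrow> 2 * card S \<le> n \<Longrightarrow>
                \<exists>s\<in>S. \<exists>u\<in>{1..n} - S. f {s, u}"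
  shows "Digraph_Component.connected (with_proj (edge_graph n f))"
proof -
  interpret pair_graph "edge_graph n f" by (rule pair_graph_edge_graph)
  let ?G = "with_proj (edge_graph n f)"
  have adj: "u \<rightarrow>\<^bsub>?G\<^esub> v \<longleftrightarrow> u \<in> {1..n} \<and> v \<in> {1..n} \<and> u \<noteq> v \<and> f {u, v}" for u v
    by simp
  have reach: "u \<rightarrow>\<^sup>*\<^bsub>?G\<^esub> v" if u: "u \<in> {1..n}" and v: "v \<in> {1..n}" for u v
  proof (rule ccontr)
    assume nr: "\<not> u \<rightarrow>\<^sup>*\<^bsub>?G\<^esub> v"
    define C where "C = {w \<in> {1..n}. u \<rightarrow>\<^sup>*\<^bsub>?G\<^esub> w}"
    have uC: "u \<in> C" using u by (simp add: C_def)
    have vC: "v \<in> {1..n} - C" using v nr by (simp add: C_def)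
    have no_edge: "\<not> f {s, t}" if "s \<in> C" "t \<in> {1..n} - C" for s t
    proof
      assume "f {s, t}"
      then have "s \<rightarrow>\<^bsub>?G\<^esub> t" using that by (subst adj) (auto simp: C_def)
      then have "u \<rightarrow>\<^sup>*\<^bsub>?G\<^esub> t" using that reachable_adj_trans by (auto simp: C_def)
      then show False using that by (auto simp: C_def)
    qed
    have "C \<subseteq> {1..n}" by (auto simp: C_def)
    then have "card ({1..n} - C) = n - card C" by (simp add: card_Diff_subset finite_subset)
    then consider "2 * card C \<le> n" | "2 * card ({1..n} - C) \<le> n" by linarith
    then show False
    proof cases
      case 1
      then obtain s t where "s \<in> C" "t \<in> {1..n} - C" "f {s, t}"
        using cut[OF \<open>C \<subseteq> _\<close>] uC by blast
      then show False using no_edge by blast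
    next
      case 2
      then obtain s t where "s \<in> {1..n} - C" "t \<in> {1..n} - ({1..n} - C)" "f {s, t}"
        using cut[of "{1..n} - C"] vC by blast
      then show False using no_edge[of t s] by (auto simp: insert_commute)
    qed
  qed
  then show ?thesis
    using n by (intro connectedI) (auto intro: reachable_mk_symmetricI)
qed

section \<open>The law of the exploration\<close>

definition pairs_of :: "'a set \<Rightarrow> 'a set set" where
  "pairs_of A = {e. e \<subseteq> A \<and> card e = 2}"

definition cross :: "'a set \<Rightarrow> 'a set \<Rightarrow> 'a set set" where
  "cross S U = (\<lambda>(s, u). {s, u}) ` (S \<times> U)"

abbreviation edges_pmf :: "'a set set \<Rightarrow> real \<Rightarrow> ('a set \<Rightarrow> bool) pmf" where
  "edges_pmf A p \<equiv> Pi_pmf A False (\<lambda>_. bernoulli_pmf p)"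

lemma vertex_pairs_eq: "vertex_pairs n = pairs_of {1..n}"
  by (simp add: vertex_pairs_def pairs_of_def)

lemma finite_pairs_of [simp]: "finite A \<Longrightarrow> finite (pairs_of A)"
  by (rule finite_subset[of _ "Pow A"]) (auto simp: pairs_of_def)

lemma finite_cross [simp]: "finite S \<Longrightarrow> finite U \<Longrightarrow> finite (cross S U)"
  by (simp add: cross_def)

lemma cross_subset_pairs_of: "S \<inter> U = {} \<Longrightarrow> S \<union> U \<subseteq> A \<Longrightarrow> cross S U \<subseteq> pairs_of A"
  by (auto simp: cross_def pairs_of_def card_insert_if)

lemma pairs_of_mono: "A \<subseteq> B \<Longrightarrow> pairs_of A \<subseteq> pairs_of B"
  by (auto simp: pairs_of_def)

lemma cross_pairs_of_disjoint: "S \<inter> U = {} \<Longrightarrow> cross S U \<inter> pairs_of U = {}"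
  by (auto simp: cross_def pairs_of_def)

lemma discovered_cong:
  "(\<And>e. e \<in> cross S U \<Longrightarrow> f e = g e) \<Longrightarrow> discovered f S U = discovered g S U"
  by (auto simp: discovered_def cross_def)

text \<open>All later frontiers lie inside \<open>U\<close>, so apart from \<open>cross S U\<close>
  only pairs inside \<open>U\<close> are ever inspected. The independence of successive levels rests
  on this.\<close>

lemma bfs_cong:
  assumes "\<And>e. e \<in> cross S U \<union> pairs_of U \<Longrightarrow> f e = g e"
  shows "bfs k f S U = bfs k g S U"
  using assms
proof (induction k arbitrary: S U)
  case (Suc k)
  define T where "T = discovered f S U"
  have T: "discovered g S U = T"
    unfolding T_def by (rule discovered_cong[symmetric]) (use Suc.prems in auto)
  have "T \<subseteq> U" by (simp add: T_def discovered_subset)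
  then have "cross T (U - T) \<union> pairs_of (U - T) \<subseteq> pairs_of U"
    using cross_subset_pairs_of[of T "U - T" U] pairs_of_mono[of "U - T" U] by auto
  then have "bfs k f T (U - T) = bfs k g T (U - T)"
    using Suc.prems by (intro Suc.IH) auto
  then show ?case using T by (simp add: T_def)
qed simp

lemma map_Pi_pmf_restrict:
  assumes "finite A" "B \<subseteq> A"
    and dep: "\<And>f g. (\<And>x. x \<in> B \<Longrightarrow> f x = g x) \<Longrightarrow> h f = h g"
  shows "map_pmf h (Pi_pmf A dflt q) = map_pmf h (Pi_pmf B dflt q)"
  unfolding Pi_pmf_subset[OF assms(1,2)] map_pmf_comp
  by (intro map_pmf_cong refl dep) auto

lemma binomial_pmf_Suc_pair:
  assumes "q \<in> {0..1}"
  shows "binomial_pmf (Suc m) q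
    = map_pmf (\<lambda>(b, k). (if b then 1 else 0) + k) (pair_pmf (bernoulli_pmf q) (binomial_pmf m q))"
  using assms by (simp add: binomial_pmf_Suc pair_pmf_def map_bind_pmf)

lemma pmf_bool_eqI:
  fixes P Q :: "bool pmf"
  assumes "pmf P False = pmf Q False"
  shows "P = Q"
proof (rule pmf_eqI)
  have "pmf R True = 1 - pmf R False" for R :: "bool pmf"
  proof -
    have "set_pmf R \<subseteq> {False, True}" by (intro subsetI) simp
    then show ?thesis using sum_pmf_eq_1[of "{False, True}" R] by simp
  qed
  then show "pmf P b = pmf Q b" for b using assms by (cases b) auto
qed

text \<open>The laws are compared at \<open>False\<close>, because the absence of all edges from
  \<open>S\<close> to \<open>u\<close> is a product event over independent pairs.\<close>

lemma exists_edge_law: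
  assumes "finite S" "u \<notin> S" "0 \<le> p" "p \<le> 1"
  shows "map_pmf (\<lambda>f. \<exists>s\<in>S. f {s, u}) (edges_pmf (cross S {u}) p) = bernoulli_pmf (1 - (1 - p) ^ card S)"
proof (rule pmf_bool_eqI)
  let ?C = "cross S {u}"
  have fin: "finite ?C" using assms by simp
  have "inj_on (\<lambda>(s, u). {s, u}) (S \<times> {u})"
    using assms(2) by (auto simp: inj_on_def doubleton_eq_iff)
  then have card: "card ?C = card S"
    by (simp add: cross_def card_image card_cartesian_product)
  have "pmf (map_pmf (\<lambda>f. \<exists>s\<in>S. f {s, u}) (edges_pmf ?C p)) False
      = measure_pmf.prob (edges_pmf ?C p) (Pi ?C (\<lambda>_. {False}))"
    unfolding pmf_map by (rule arg_cong[of _ _ "measure_pmf.prob _"]) (auto simp: cross_def Pi_def)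
  also have "\<dots> = (\<Prod>e\<in>?C. measure_pmf.prob (bernoulli_pmf p) {False})"
    by (rule measure_Pi_pmf_Pi[OF fin])
  also have "\<dots> = (1 - p) ^ card S"
    using assms by (simp add: measure_pmf_single card)
  also have "\<dots> = pmf (bernoulli_pmf (1 - (1 - p) ^ card S)) False"
    using assms by (simp add: power_le_one)
  finally show "pmf (map_pmf (\<lambda>f. \<exists>s\<in>S. f {s, u}) (edges_pmf ?C p)) False
      = pmf (bernoulli_pmf (1 - (1 - p) ^ card S)) False" .
qed

text \<open>Different \<open>u\<close> depend on disjoint sets of pairs, so the count is a sum of
  independent indicators with the parameter of \<open>exists_edge_law\<close>; the induction splits
  off the pairs at one vertex.\<close>

lemma card_discovered_law:
  assumes "finite S" "finite U" "S \<inter> U = {}" "0 \<le> p" "p \<le> 1"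
  shows "map_pmf (\<lambda>f. card (discovered f S U)) (edges_pmf (cross S U) p)
    = binomial_pmf (card U) (1 - (1 - p) ^ card S)"
  using assms(2,3)
proof (induction U rule: finite_induct)
  case empty
  show ?case using assms by (simp add: cross_def discovered_def binomial_pmf_0 power_le_one)
next
  case (insert u U)
  let ?q = "1 - (1 - p) ^ card S"
  have q: "?q \<in> {0..1}" using assms by (simp add: power_le_one)
  have un: "cross S (insert u U) = cross S {u} \<union> cross S U"
    by (auto simp: cross_def)
  have disj: "cross S {u} \<inter> cross S U = {}"
    using insert.hyps insert.prems by (auto simp: cross_def doubleton_eq_iff)
  have card: "card (discovered (\<lambda>x. if x \<in> cross S {u} then f x else g x) S (insert u U))
      = (if \<exists>s\<in>S. f {s, u} then 1 else 0) + card (discovered g S U)" for f g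
  proof -
    let ?h = "\<lambda>x. if x \<in> cross S {u} then f x else g x"
    have "?h {s, u} = f {s, u}" if "s \<in> S" for s
      using that by (auto simp: cross_def)
    moreover have "discovered ?h S U = discovered g S U"
      by (rule discovered_cong) (use disj in auto)
    moreover have "discovered h S (insert u U)
        = (if \<exists>s\<in>S. h {s, u} then insert u (discovered h S U) else discovered h S U)" for h
      by (auto simp: discovered_def)
    ultimately have "discovered ?h S (insert u U)
        = (if \<exists>s\<in>S. f {s, u} then insert u (discovered g S U) else discovered g S U)"
      by (metis (no_types, lifting))
    moreover have "finite (discovered g S U)" "u \<notin> discovered g S U"
      using insert.hyps finite_subset[OF discovered_subset[of g S U]] by (auto simp: discovered_def)
    ultimately show ?thesis by simp
  qed
  have "map_pmf (\<lambda>f. card (discovered f S (insert u U))) (edges_pmf (cross S (insert u U)) p)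
      = map_pmf (\<lambda>(f, g). (if \<exists>s\<in>S. f {s, u} then 1 else 0) + card (discovered g S U))
          (pair_pmf (edges_pmf (cross S {u}) p) (edges_pmf (cross S U) p))"
    unfolding un using assms insert.hyps disj
    by (subst Pi_pmf_union) (simp_all add: map_pmf_comp case_prod_unfold card)
  also have "\<dots> = map_pmf (\<lambda>(b, k). (if b then 1 else 0) + k)
      (pair_pmf (map_pmf (\<lambda>f. \<exists>s\<in>S. f {s, u}) (edges_pmf (cross S {u}) p))
        (map_pmf (\<lambda>f. card (discovered f S U)) (edges_pmf (cross S U) p)))"
    unfolding pair_map_pmf1 pair_map_pmf2 map_pmf_comp by (simp add: case_prod_unfold)
  also have "\<dots> = binomial_pmf (card (insert u U)) ?q"
    using insert assms q by (simp add: exists_edge_law binomial_pmf_Suc_pair)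
  finally show ?case .
qed

text \<open>This is the Reed-Frost epidemic chain, with \<open>s\<close> infectious and
  \<open>m\<close> susceptible individuals. It recurses on the first step, in parallel with
  \<open>bfs\<close>.\<close>

fun chain :: "real \<Rightarrow> nat \<Rightarrow> nat \<Rightarrow> nat \<Rightarrow> (nat \<times> nat) pmf" where
  "chain p 0 s m = return_pmf (s, m)"
| "chain p (Suc k) s m = bind_pmf (binomial_pmf m (1 - (1 - p) ^ s)) (\<lambda>t. chain p k t (m - t))"

text \<open>Deferred decisions: the pairs in \<open>cross S U\<close> determine the first step, and
  the rest of the exploration uses only the independent pairs inside \<open>U\<close>. The ambient
  set \<open>A\<close> is left arbitrary so that the induction hypothesis can be applied with
  \<open>pairs_of U\<close>.\<close>

lemma bfs_law:
  assumes "finite A" "cross S U \<union> pairs_of U \<subseteq> A"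
    and "finite S" "finite U" "S \<inter> U = {}" "0 \<le> p" "p \<le> 1"
  shows "map_pmf (\<lambda>f. map_prod card card (bfs k f S U)) (edges_pmf A p)
    = chain p k (card S) (card U)"
  using assms(1-5)
proof (induction k arbitrary: S U A)
  case 0
  then show ?case by simp
next
  case (Suc k)
  let ?h = "\<lambda>f. map_prod card card (bfs (Suc k) f S U)"
  let ?T = "\<lambda>f. discovered f S U"
  let ?m = "\<lambda>f g x. if x \<in> cross S U then f x else g x"
  have disj: "cross S U \<inter> pairs_of U = {}"
    using Suc.prems by (intro cross_pairs_of_disjoint)
  \<comment> \<open>After the first step only \<open>g\<close> matters: every later query lies in
    \<open>pairs_of U\<close>, which is disjoint from the pairs already exposed through
    \<open>f\<close>.\<close>
  have merge: "?h (?m f g) = map_prod card card (bfs k g (?T f) (U - ?T f))" for f g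
  proof -
    have T: "?T (?m f g) = ?T f" by (rule discovered_cong) simp
    have "cross (?T f) (U - ?T f) \<union> pairs_of (U - ?T f) \<subseteq> pairs_of U"
      using cross_subset_pairs_of[of "?T f" "U - ?T f" U] pairs_of_mono[of "U - ?T f" U]
        discovered_subset[of f S U] by auto
    then have "bfs k (?m f g) (?T f) (U - ?T f) = bfs k g (?T f) (U - ?T f)"
      using disj by (intro bfs_cong) auto
    then show ?thesis using T by simp
  qed
  have inner: "map_pmf (\<lambda>g. map_prod card card (bfs k g (?T f) (U - ?T f))) (edges_pmf (pairs_of U) p)
      = chain p k (card (?T f)) (card U - card (?T f))" for f
  proof -
    have sub: "?T f \<subseteq> U" by (rule discovered_subset)
    have "cross (?T f) (U - ?T f) \<union> pairs_of (U - ?T f) \<subseteq> pairs_of U"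
      using cross_subset_pairs_of[of "?T f" "U - ?T f" U] pairs_of_mono[of "U - ?T f" U] sub by auto
    moreover have fin: "finite (?T f)" using Suc.prems sub finite_subset by blast
    ultimately have "map_pmf (\<lambda>g. map_prod card card (bfs k g (?T f) (U - ?T f))) (edges_pmf (pairs_of U) p)
      = chain p k (card (?T f)) (card (U - ?T f))"
      using Suc.prems by (intro Suc.IH) auto
    then show ?thesis using sub fin by (simp add: card_Diff_subset)
  qed
  have "map_pmf ?h (edges_pmf A p) = map_pmf ?h (edges_pmf (cross S U \<union> pairs_of U) p)"
  proof (rule map_Pi_pmf_restrict)
    fix f g :: "'a set \<Rightarrow> bool"
    assume "\<And>x. x \<in> cross S U \<union> pairs_of U \<Longrightarrow> f x = g x"
    then show "?h f = ?h g" using bfs_cong[of S U f g "Suc k"] by simp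
  qed (use Suc.prems in auto)
  also have "\<dots> = map_pmf (\<lambda>(f, g). ?h (?m f g))
      (pair_pmf (edges_pmf (cross S U) p) (edges_pmf (pairs_of U) p))"
    using Suc.prems disj by (subst Pi_pmf_union) (simp_all add: map_pmf_comp case_prod_unfold)
  also have "\<dots> = bind_pmf (edges_pmf (cross S U) p) (\<lambda>f.
      map_pmf (\<lambda>g. map_prod card card (bfs k g (?T f) (U - ?T f))) (edges_pmf (pairs_of U) p))"
    unfolding merge pair_pmf_def map_bind_pmf by (simp add: map_pmf_def bind_assoc_pmf bind_return_pmf)
  also have "\<dots> = bind_pmf (edges_pmf (cross S U) p)
      (\<lambda>f. chain p k (card (?T f)) (card U - card (?T f)))"
    unfolding inner ..
  also have "\<dots> = bind_pmf (map_pmf (\<lambda>f. card (?T f)) (edges_pmf (cross S U) p))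
      (\<lambda>t. chain p k t (card U - t))"
    by (simp add: bind_map_pmf)
  also have "\<dots> = chain p (Suc k) (card S) (card U)"
    using Suc.prems assms(6,7) by (simp add: card_discovered_law)
  finally show ?case .
qed

lemma unreached_law:
  assumes "S \<subseteq> {1..n}" "0 \<le> p" "p \<le> 1"
  shows "map_pmf (\<lambda>f. card (unreached k f S ({1..n} - S))) (edges_pmf (vertex_pairs n) p)
    = map_pmf snd (chain p k (card S) (n - card S))"
proof -
  have fin: "finite S" using assms(1) finite_subset by blast
  have "map_pmf (\<lambda>f. card (unreached k f S ({1..n} - S))) (edges_pmf (vertex_pairs n) p)
    = map_pmf snd (map_pmf (\<lambda>f. map_prod card card (bfs k f S ({1..n} - S)))
        (edges_pmf (vertex_pairs n) p))"
    by (simp add: map_pmf_comp unreached_def)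
  also have "\<dots> = map_pmf snd (chain p k (card S) (card ({1..n} - S)))"
    using assms fin cross_subset_pairs_of[of S "{1..n} - S" "{1..n}"] pairs_of_mono[of "{1..n} - S" "{1..n}"]
    by (subst bfs_law) (auto simp: vertex_pairs_eq)
  finally show ?thesis using assms fin by (simp add: card_Diff_subset)
qed

text \<open>The definition conditions on the first level, which suits the upper bound on growth. The
  lower tail and the final covering step condition on the last level instead.\<close>

lemma chain_Suc_right:
  "chain p (Suc k) s m = bind_pmf (chain p k s m) (\<lambda>(t, u). chain p 1 t u)"
proof (induction k arbitrary: s m)
  case 0
  then show ?case by (simp add: bind_return_pmf)
next
  case (Suc k)
  have "chain p (Suc (Suc k)) s m = bind_pmf (binomial_pmf m (1 - (1 - p) ^ s))
      (\<lambda>x. bind_pmf (chain p k x (m - x)) (\<lambda>(t, u). chain p 1 t u))"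
    by (subst chain.simps(2)) (simp only: Suc.IH)
  also have "\<dots> = bind_pmf (chain p (Suc k) s m) (\<lambda>(t, u). chain p 1 t u)"
    by (simp only: chain.simps(2)[of p k] bind_assoc_pmf)
  finally show ?case .
qed

section \<open>Supports and expectations for the chain\<close>

lemma set_binomial_pmf_subset: "0 \<le> q \<Longrightarrow> q \<le> 1 \<Longrightarrow> set_pmf (binomial_pmf m q) \<subseteq> {..m}"
  by (subst set_pmf_binomial_eq) auto

lemma hit_prob:
  fixes p :: real
  assumes "0 \<le> p" "p \<le> 1"
  shows "0 \<le> 1 - (1 - p) ^ s" "1 - (1 - p) ^ s \<le> 1"
  using assms by (simp_all add: power_le_one)

lemma set_chain:
  assumes "0 \<le> p" "p \<le> 1" "(t, u) \<in> set_pmf (chain p k s m)"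
  shows "t + u \<le> s + m \<and> u \<le> m"
  using assms(3)
proof (induction k arbitrary: s m)
  case (Suc k)
  then obtain x where x: "x \<in> set_pmf (binomial_pmf m (1 - (1 - p) ^ s))"
      "(t, u) \<in> set_pmf (chain p k x (m - x))"
    by auto
  have "x \<le> m"
    using x(1) set_binomial_pmf_subset[OF hit_prob[OF assms(1,2)], of m s] by auto
  then show ?case using Suc.IH[OF x(2)] by simp
qed simp

lemma finite_set_chain [simp]:
  assumes "0 \<le> p" "p \<le> 1"
  shows "finite (set_pmf (chain p k s m))"
proof (rule finite_subset)
  show "set_pmf (chain p k s m) \<subseteq> {..s + m} \<times> {..s + m}"
    using set_chain[OF assms] by (fastforce dest: set_chain[OF assms])
qed simp

lemma expectation_mono_finite:
  fixes f g :: "'a \<Rightarrow> real"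
  assumes "finite (set_pmf M)" "\<And>x. x \<in> set_pmf M \<Longrightarrow> f x \<le> g x"
  shows "measure_pmf.expectation M f \<le> measure_pmf.expectation M g"
  using assms by (intro integral_mono_AE integrable_measure_pmf_finite) (auto simp: AE_measure_pmf_iff)

lemma expectation_bind_finite:
  fixes h :: "'b \<Rightarrow> real"
  assumes "finite (set_pmf M)" "\<And>x. x \<in> set_pmf M \<Longrightarrow> finite (set_pmf (N x))"
  shows "measure_pmf.expectation (bind_pmf M N) h
    = measure_pmf.expectation M (\<lambda>x. measure_pmf.expectation (N x) h)"
  using assms by (subst pmf_expectation_bind[of "set_pmf M"], simp_all)
     (subst integral_measure_pmf[of "set_pmf M"], simp_all)

lemma expectation_binomial_power:
  fixes q x :: real
  assumes "0 \<le> q" "q \<le> 1"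
  shows "measure_pmf.expectation (binomial_pmf m q) (\<lambda>t. x ^ t) = (1 - q + q * x) ^ m"
proof -
  have "measure_pmf.expectation (binomial_pmf m q) (\<lambda>t. x ^ t)
      = (\<Sum>k\<le>m. (real (m choose k) * q ^ k * (1 - q) ^ (m - k)) * x ^ k)"
    using assms by (subst expectation_binomial_pmf') auto
  also have "\<dots> = (\<Sum>k\<le>m. real (m choose k) * (q * x) ^ k * (1 - q) ^ (m - k))"
    by (intro sum.cong) (auto simp: power_mult_distrib)
  also have "\<dots> = (q * x + (1 - q)) ^ m"
    by (rule binomial_ring[symmetric])
  finally show ?thesis by (simp add: algebra_simps)
qed

lemma expectation_chain_Suc:
  assumes "0 \<le> p" "p \<le> 1"
  shows "measure_pmf.expectation (chain p (Suc k) s m) h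
    = measure_pmf.expectation (binomial_pmf m (1 - (1 - p) ^ s))
        (\<lambda>t. measure_pmf.expectation (chain p k t (m - t)) (h :: _ \<Rightarrow> real))"
  using assms hit_prob[OF assms]
  by (simp, subst expectation_bind_finite) auto

lemma expectation_chain_Suc_right:
  assumes "0 \<le> p" "p \<le> 1"
  shows "measure_pmf.expectation (chain p (Suc k) s m) h
    = measure_pmf.expectation (chain p k s m)
        (\<lambda>(t, u). measure_pmf.expectation (binomial_pmf u (1 - (1 - p) ^ t)) (\<lambda>x. h (x, u - x) :: real))"
proof -
  have step: "measure_pmf.expectation (chain p 1 t u) h
      = measure_pmf.expectation (binomial_pmf u (1 - (1 - p) ^ t)) (\<lambda>x. h (x, u - x))" for t u
    using expectation_chain_Suc[OF assms, of 0 t u h] by simp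
  show ?thesis
    unfolding chain_Suc_right
    using assms
    by (subst expectation_bind_finite) (auto simp del: One_nat_def simp: step case_prod_unfold)
qed

section \<open>Upper bounds for the exploration\<close>

text \<open>Multiplying the right side by the Taylor bound \<open>1 + x + x\<^sup>2 / 2\<close> for
  \<open>exp x\<close> gives \<open>1 + x ^ 4 / 4\<close>, which is at least 1.\<close>

lemma exp_minus_le_quadratic:
  fixes x :: real
  assumes "0 \<le> x"
  shows "exp (- x) \<le> 1 - x + x\<^sup>2 / 2"
proof -
  have "1 \<le> (1 - x + x\<^sup>2 / 2) * (1 + x + x\<^sup>2 / 2)"
  proof -
    have "(1 - x + x\<^sup>2 / 2) * (1 + x + x\<^sup>2 / 2) = 1 + (x\<^sup>2)\<^sup>2 / 4"
      by (simp add: power2_eq_square field_simps)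
    then show ?thesis by simp
  qed
  also have "\<dots> \<le> (1 - x + x\<^sup>2 / 2) * exp x"
  proof (rule mult_left_mono)
    show "0 \<le> 1 - x + x\<^sup>2 / 2"
      using zero_le_power2[of "1 - x"] by (simp add: power2_diff)
  qed (use assms in \<open>rule exp_lower_Taylor_quadratic\<close>)
  finally show ?thesis by (simp add: exp_minus field_simps)
qed

lemma one_plus_power_le_exp:
  fixes x :: real
  assumes "- 1 \<le> x"
  shows "(1 + x) ^ m \<le> exp (real m * x)"
proof -
  have "(1 + x) ^ m \<le> exp x ^ m"
    using assms by (intro power_mono) auto
  then show ?thesis by (simp add: exp_of_nat_mult)
qed

lemma hit_prob_le:
  fixes p :: real
  assumes "0 \<le> p" "p \<le> 1"
  shows "1 - (1 - p) ^ s \<le> p * real s"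
  using Bernoulli_inequality[of "- p" s] assms by (simp add: mult.commute)

lemma prob_le_expectation:
  fixes g :: "'a \<Rightarrow> real"
  assumes "finite (set_pmf M)" "\<And>x. x \<in> set_pmf M \<Longrightarrow> 0 \<le> g x"
    and "\<And>x. x \<in> set_pmf M \<Longrightarrow> x \<in> A \<Longrightarrow> 1 \<le> g x"
  shows "measure_pmf.prob M A \<le> measure_pmf.expectation M g"
proof -
  have "measure_pmf.prob M A = measure_pmf.expectation M (indicator A)"
    by simp
  also have "\<dots> \<le> measure_pmf.expectation M g"
    using assms by (intro expectation_mono_finite) (auto simp: indicator_def)
  finally show ?thesis .
qed

text \<open>The right side is the moment generating function of a Poisson variable with mean
  \<open>d * s\<close>. Being exponential in \<open>s\<close>, it can be fed back into the same
  bound at the preceding level.\<close>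

lemma expectation_binomial_exp_le:
  fixes p a :: real
  assumes p: "0 \<le> p" "p \<le> 1" and m: "p * real m \<le> d" and a: "0 \<le> a"
  shows "measure_pmf.expectation (binomial_pmf m (1 - (1 - p) ^ s)) (\<lambda>t. exp (a * real t))
    \<le> exp (d * (exp a - 1) * real s)"
proof -
  let ?q = "1 - (1 - p) ^ s"
  have q: "0 \<le> ?q" "?q \<le> 1" using hit_prob[OF p] by auto
  have "measure_pmf.expectation (binomial_pmf m ?q) (\<lambda>t. exp (a * real t))
      = measure_pmf.expectation (binomial_pmf m ?q) (\<lambda>t. exp a ^ t)"
    by (simp only: exp_of_nat_mult mult.commute[of a])
  also have "\<dots> = (1 + ?q * (exp a - 1)) ^ m"
    using expectation_binomial_power[OF q, of m "exp a"] by (simp add: algebra_simps)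
  also have "\<dots> \<le> exp (real m * (?q * (exp a - 1)))"
  proof (rule one_plus_power_le_exp)
    have "0 \<le> ?q * (exp a - 1)" using q a by simp
    then show "- 1 \<le> ?q * (exp a - 1)" by linarith
  qed
  also have "\<dots> \<le> exp (d * (exp a - 1) * real s)"
  proof -
    have "real m * (?q * (exp a - 1)) \<le> real m * (p * real s * (exp a - 1))"
      using hit_prob_le[OF p, of s] a by (intro mult_left_mono mult_right_mono) auto
    also have "\<dots> = (p * real m) * ((exp a - 1) * real s)" by simp
    also have "\<dots> \<le> d * ((exp a - 1) * real s)"
      using m a by (intro mult_right_mono) auto
    finally show ?thesis by (simp add: mult.assoc)
  qed
  finally show ?thesis .
qed

text \<open>Here \<open>m - u\<close> counts the vertices discovered so far, and
  \<open>\<phi>\<close> is a supersolution of the recursion for the log moment generating function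
  of the progeny, roots excluded, in a Galton-Watson process with Poisson offspring of mean
  \<open>d\<close>. Conditioning on the first step turns \<open>\<phi> k\<close> into
  \<open>lam + \<phi> k\<close> per newly discovered vertex; the bound on \<open>p * m\<close>
  survives because \<open>m\<close> only decreases.\<close>

lemma chain_mgf_le:
  fixes p lam :: real and \<phi> :: "nat \<Rightarrow> real"
  assumes p: "0 \<le> p" "p \<le> 1" and m: "p * real m \<le> d" and lam: "0 \<le> lam"
    and \<phi>: "\<And>j. j \<le> K \<Longrightarrow> 0 \<le> \<phi> j" "\<And>j. j < K \<Longrightarrow> d * (exp (lam + \<phi> j) - 1) \<le> \<phi> (Suc j)"
    and k: "k \<le> K"
  shows "measure_pmf.expectation (chain p k s m) (\<lambda>(t, u). exp (lam * (real m - real u)))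
    \<le> exp (\<phi> k * real s)"
  using m k
proof (induction k arbitrary: s m)
  case 0
  then show ?case using \<phi>(1)[of 0] by simp
next
  case (Suc k)
  let ?M = "binomial_pmf m (1 - (1 - p) ^ s)"
  have fin: "finite (set_pmf ?M)" using hit_prob[OF p] by auto
  have "measure_pmf.expectation (chain p (Suc k) s m) (\<lambda>(t, u). exp (lam * (real m - real u)))
      = measure_pmf.expectation ?M (\<lambda>x. measure_pmf.expectation (chain p k x (m - x))
          (\<lambda>(t, u). exp (lam * (real m - real u))))"
    by (rule expectation_chain_Suc[OF p])
  also have "\<dots> \<le> measure_pmf.expectation ?M (\<lambda>x. exp ((lam + \<phi> k) * real x))"
  proof (rule expectation_mono_finite[OF fin])
    fix x assume "x \<in> set_pmf ?M"
    then have x: "x \<le> m" using set_binomial_pmf_subset[OF hit_prob[OF p], of m s] by auto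
    have eq: "(\<lambda>(t, u). exp (lam * (real m - real u)))
        = (\<lambda>z :: nat \<times> nat. exp (lam * real x) * (\<lambda>(t, u). exp (lam * (real (m - x) - real u))) z)"
      using x by (auto simp: fun_eq_iff exp_add[symmetric] of_nat_diff algebra_simps)
    have "p * real (m - x) \<le> p * real m" using p by (intro mult_left_mono) auto
    then have "measure_pmf.expectation (chain p k x (m - x))
          (\<lambda>(t, u). exp (lam * (real (m - x) - real u))) \<le> exp (\<phi> k * real x)"
      using Suc.prems by (intro Suc.IH) auto
    then show "measure_pmf.expectation (chain p k x (m - x)) (\<lambda>(t, u). exp (lam * (real m - real u)))
        \<le> exp ((lam + \<phi> k) * real x)"
      unfolding eq by (simp add: exp_add distrib_right)
  qed
  also have "\<dots> \<le> exp (d * (exp (lam + \<phi> k) - 1) * real s)"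
    using p Suc.prems lam \<phi>(1)[of k] by (intro expectation_binomial_exp_le) auto
  also have "\<dots> \<le> exp (\<phi> (Suc k) * real s)"
    using \<phi>(2)[of k] Suc.prems by (simp add: mult_right_mono)
  finally show ?case .
qed

text \<open>
  The exponents \<open>a j\<close> of the moment generating function satisfy \<open>a (j + 1) = lam + d (exp (a j) - 1)\<close>.
  For \<open>lam = \<mu> / d ^ k\<close> the sequence
  \<open>lam * d ^ j * exp (2 / d * (1 - 1 / d ^ j) + 4 * \<mu> / d * (d ^ j / d ^ k))\<close> is a supersolution:
  the first summand pays for \<open>lam\<close>, the second for the quadratic term of the exponential.
\<close>
lemma chain_growth_mgf:
  fixes p d \<mu> :: real
  assumes p: "0 \<le> p" "p \<le> 1" and m: "p * real m \<le> d" and d: "2 \<le> d" and \<mu>: "0 < \<mu>"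
    and small: "exp ((2 + 4 * \<mu>) / d) \<le> 2"
  shows "measure_pmf.expectation (chain p k s m)
      (\<lambda>(t, u). exp (\<mu> / d ^ k * (real s + real m - real u)))
    \<le> exp (real s * \<mu> * exp ((2 + 4 * \<mu>) / d))"
proof -
  define lam where "lam = \<mu> / d ^ k"
  define e where "e j = 2 / d * (1 - 1 / d ^ j) + 4 * \<mu> / d * (d ^ j / d ^ k)" for j
  define a where "a j = lam * d ^ j * exp (e j)" for j
  have lam: "0 < lam" using \<mu> d by (simp add: lam_def)
  have pow: "1 \<le> d ^ j" for j using d by simp
  have e_nonneg: "0 \<le> e j" for j
    unfolding e_def using d \<mu> pow[of j] by (intro add_nonneg_nonneg mult_nonneg_nonneg) auto
  have e_le: "e j \<le> (2 + 4 * \<mu>) / d" if "j \<le> k" for j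
  proof -
    have "2 / d * (1 - 1 / d ^ j) \<le> 2 / d * 1"
      using d pow[of j] by (intro mult_left_mono) auto
    moreover have "4 * \<mu> / d * (d ^ j / d ^ k) \<le> 4 * \<mu> / d * 1"
      using d \<mu> that by (intro mult_left_mono) (auto simp: power_increasing)
    ultimately show ?thesis by (simp add: e_def add_divide_distrib)
  qed
  have e_exp: "exp (e j) \<le> 2" if "j \<le> k" for j
    using e_le[OF that] small by (meson exp_le_cancel_iff order_trans)
  have a_ge: "lam \<le> a j" for j
  proof -
    have "1 * 1 \<le> d ^ j * exp (e j)" using pow[of j] e_nonneg[of j] by (intro mult_mono) auto
    then have "lam * 1 \<le> lam * (d ^ j * exp (e j))" using lam by (intro mult_left_mono) auto
    then show ?thesis by (simp add: a_def mult.assoc)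
  qed
  have step: "lam + d * (exp (a j) - 1) \<le> a (Suc j)" if j: "j < k" for j
  proof -
    \<comment> \<open>The inequality \<open>1 + x \<le> exp x\<close> extracts from
      \<open>small\<close> that \<open>\<mu>\<close> is at most a quarter of \<open>d\<close>. This
      keeps \<open>a j\<close> below 1, where the quadratic bound on \<open>exp\<close>
      applies.\<close>
    have "1 + (2 + 4 * \<mu>) / d \<le> 2"
      using exp_ge_add_one_self[of "(2 + 4 * \<mu>) / d"] small by linarith
    then have \<mu>d: "2 + 4 * \<mu> \<le> d" using d by (simp add: field_simps)
    define r where "r = d ^ j / d ^ k"
    have "d ^ k = d ^ Suc j * d ^ (k - Suc j)"
      using j by (simp only: power_add[symmetric]) simp
    then have "d ^ Suc j \<le> d ^ k" using j d by (intro power_increasing) auto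
    then have r: "0 < r" "r \<le> 1 / d"
      using d by (auto simp: r_def field_simps)
    have a_eq: "a j = \<mu> * r * exp (e j)" by (simp add: a_def lam_def r_def)
    have a_le: "a j \<le> 2 * \<mu> * r"
      using e_exp[of j] j \<mu> r by (simp add: a_eq mult_left_mono)
    have "2 * \<mu> * r \<le> 2 * \<mu> * (1 / d)" using r \<mu> by (intro mult_left_mono) auto
    also have "\<dots> \<le> 1" using \<mu>d \<mu> d by (simp add: field_simps)
    finally have a1: "a j \<le> 1" using a_le by simp
    have a0: "0 \<le> a j" using a_ge[of j] lam by simp
    \<comment> \<open>The coefficients \<open>2 / d\<close> and \<open>4 * \<mu> / d\<close> in
      \<open>e\<close> are twice what is needed; the factor \<open>1 - 1 / d \<ge> 1 / 2\<close>
      uses up the surplus.\<close>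
    have "e (Suc j) - e j = 2 / d * (1 / d ^ j) * (1 - 1 / d) + 4 * \<mu> * r * (1 - 1 / d)"
      using d by (simp add: e_def r_def field_simps)
    moreover have "2 / d * (1 / d ^ j) * (1 / 2) \<le> 2 / d * (1 / d ^ j) * (1 - 1 / d)"
      using d by (intro mult_left_mono) (auto simp: field_simps)
    moreover have "4 * \<mu> * r * (1 / 2) \<le> 4 * \<mu> * r * (1 - 1 / d)"
      using d \<mu> r by (intro mult_left_mono) (auto simp: field_simps)
    ultimately have diff: "1 / d ^ Suc j + a j \<le> e (Suc j) - e j"
      using a_le by simp
    \<comment> \<open>After division by \<open>lam * d ^ Suc j\<close>, the summand
      \<open>lam\<close> becomes \<open>1 / d ^ Suc j\<close> and the quadratic term becomes
      \<open>exp (e j) * a j\<close>; the growth of \<open>e\<close> absorbs both.\<close>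
    have "exp (e j) + 1 / d ^ Suc j + exp (e j) * a j \<le> exp (e j) * (1 + (1 / d ^ Suc j + a j))"
      using e_nonneg[of j] d mult_right_mono[of 1 "exp (e j)" "1 / d ^ Suc j"]
      by (simp add: algebra_simps)
    also have "\<dots> \<le> exp (e j) * (1 + (e (Suc j) - e j))"
      using diff by (intro mult_left_mono) auto
    also have "\<dots> \<le> exp (e j) * exp (e (Suc j) - e j)"
      by (intro mult_left_mono exp_ge_add_one_self) auto
    also have "\<dots> = exp (e (Suc j))" by (simp add: exp_add[symmetric])
    finally have "lam * d ^ Suc j * (exp (e j) + 1 / d ^ Suc j + exp (e j) * a j) \<le> a (Suc j)"
      unfolding a_def[of "Suc j"] using lam d by (intro mult_left_mono) auto
    moreover have "lam * d ^ Suc j * (exp (e j) + 1 / d ^ Suc j + exp (e j) * a j)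
        = lam + d * (a j + a j * a j)"
      using d by (simp add: a_def[of j] field_simps)
    moreover have "d * (exp (a j) - 1) \<le> d * (a j + a j * a j)"
      using exp_bound[OF a0 a1] d by (intro mult_left_mono) (auto simp: power2_eq_square)
    ultimately show ?thesis by linarith
  qed
  \<comment> \<open>The exponent \<open>a\<close> also charges the \<open>s\<close> starting
    vertices, which \<open>m - u\<close> omits. Hence \<open>a j - lam\<close> is the supersolution,
    and the factor \<open>exp (lam * s)\<close> is restored afterwards.\<close>
  have "measure_pmf.expectation (chain p k s m) (\<lambda>(t, u). exp (lam * (real m - real u)))
      \<le> exp ((a k - lam) * real s)"
  proof (rule chain_mgf_le[where K = k and d = d])
    show "0 \<le> a j - lam" for j using a_ge[of j] by simp
    show "d * (exp (lam + (a j - lam)) - 1) \<le> a (Suc j) - lam" if "j < k" for j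
      using step[OF that] by simp
  qed (use p m lam in auto)
  then have "exp (lam * real s) * measure_pmf.expectation (chain p k s m)
        (\<lambda>(t, u). exp (lam * (real m - real u))) \<le> exp (lam * real s) * exp ((a k - lam) * real s)"
    by (intro mult_left_mono) auto
  also have "\<dots> = exp (a k * real s)" by (simp add: exp_add[symmetric] algebra_simps)
  also have "\<dots> \<le> exp (real s * \<mu> * exp ((2 + 4 * \<mu>) / d))"
  proof -
    have "a k = \<mu> * exp (e k)" using d by (simp add: a_def lam_def)
    also have "\<dots> \<le> \<mu> * exp ((2 + 4 * \<mu>) / d)"
      using e_le[of k] \<mu> by (intro mult_left_mono) auto
    finally have "a k * real s \<le> \<mu> * exp ((2 + 4 * \<mu>) / d) * real s"
      by (intro mult_right_mono) auto
    then show ?thesis by (simp add: mult_ac)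
  qed
  also have "exp (lam * real s) * measure_pmf.expectation (chain p k s m)
        (\<lambda>(t, u). exp (lam * (real m - real u)))
      = measure_pmf.expectation (chain p k s m) (\<lambda>(t, u). exp (lam * (real s + real m - real u)))"
    by (subst integral_mult_right_zero[symmetric], rule Bochner_Integration.integral_cong)
       (auto simp: exp_add[symmetric] algebra_simps)
  finally show ?thesis by (simp add: lam_def)
qed

text \<open>Chernoff's bound for the size \<open>s + m - u\<close> of the ball. With the exponent
  scaled to \<open>\<mu> / d ^ k\<close> the power of \<open>d\<close> cancels, so the bound does
  not depend on the level.\<close>

lemma chain_growth_tail:
  fixes p d \<mu> B :: real
  assumes "0 \<le> p" "p \<le> 1" "p * real m \<le> d" "2 \<le> d" "0 < \<mu>" "exp ((2 + 4 * \<mu>) / d) \<le> 2"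
  shows "measure_pmf.prob (chain p k s m) {(t, u). B * d ^ k < real s + real m - real u}
    \<le> exp (\<mu> * (real s * exp ((2 + 4 * \<mu>) / d) - B))"
proof -
  have fin: "finite (set_pmf (chain p k s m))" using assms by simp
  have "measure_pmf.prob (chain p k s m) {(t, u). B * d ^ k < real s + real m - real u}
      \<le> measure_pmf.expectation (chain p k s m)
          (\<lambda>z. exp (- \<mu> * B) * (\<lambda>(t, u). exp (\<mu> / d ^ k * (real s + real m - real u))) z)"
  proof (rule prob_le_expectation[OF fin])
    fix z assume "z \<in> {(t :: nat, u). B * d ^ k < real s + real m - real u}"
    then obtain t u where z: "z = (t, u)" and B: "B * d ^ k < real s + real m - real u"
      by (cases z) auto
    have "\<mu> / d ^ k * (B * d ^ k) \<le> \<mu> / d ^ k * (real s + real m - real u)"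
      using B assms by (intro mult_left_mono) auto
    then have "0 \<le> - \<mu> * B + \<mu> / d ^ k * (real s + real m - real u)"
      using assms by simp
    then show "1 \<le> exp (- \<mu> * B) * (\<lambda>(t, u). exp (\<mu> / d ^ k * (real s + real m - real u))) z"
      unfolding z by (simp only: exp_add[symmetric] split_conv one_le_exp_iff)
  qed auto
  also have "\<dots> \<le> exp (- \<mu> * B) * exp (real s * \<mu> * exp ((2 + 4 * \<mu>) / d))"
    using chain_growth_mgf[OF assms, of k s]
    by (simp only: integral_mult_right_zero) (intro mult_left_mono, auto)
  also have "\<dots> = exp (\<mu> * (real s * exp ((2 + 4 * \<mu>) / d) - B))"
    by (simp add: exp_add[symmetric] algebra_simps)
  finally show ?thesis .
qed

section \<open>Lower bounds for the exploration\<close>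

text \<open>The cap \<open>B\<close> limits both the frontier and the set of explored vertices.
  Overlapping neighbourhoods and the loss of unexplored vertices each cost a factor
  \<open>1 - p * B / 2\<close> (for the latter, \<open>d \<ge> 2\<close> converts the additive loss
  \<open>p * B\<close>), so the mean is at least \<open>d * s * (1 - p * B)\<close>. The factor
  \<open>1 - \<theta> / 2\<close> is the second-order loss of the Laplace transform.\<close>

lemma expectation_binomial_exp_minus_le:
  fixes p \<theta> B n d :: real
  assumes p: "0 \<le> p" "p \<le> 1" and \<theta>: "0 \<le> \<theta>" and d: "2 \<le> d" "d \<le> p * n"
    and B: "real s \<le> B" "n - real m \<le> B" "p * B \<le> 1"
  shows "measure_pmf.expectation (binomial_pmf m (1 - (1 - p) ^ s)) (\<lambda>t. exp (- \<theta> * real t))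
    \<le> exp (- (\<theta> * (1 - \<theta> / 2) * d * (1 - p * B)) * real s)"
proof -
  let ?q = "1 - (1 - p) ^ s"
  have q: "0 \<le> ?q" "?q \<le> 1" using hit_prob[OF p] by auto
  have "measure_pmf.expectation (binomial_pmf m ?q) (\<lambda>t. exp (- \<theta> * real t))
      = measure_pmf.expectation (binomial_pmf m ?q) (\<lambda>t. exp (- \<theta>) ^ t)"
    by (simp only: exp_of_nat_mult mult.commute[of "- \<theta>"])
  also have "\<dots> = (1 + (- (?q * (1 - exp (- \<theta>))))) ^ m"
    using expectation_binomial_power[OF q, of m "exp (- \<theta>)"] by (simp add: algebra_simps)
  also have "\<dots> \<le> exp (real m * (- (?q * (1 - exp (- \<theta>)))))"
  proof (rule one_plus_power_le_exp)
    have "?q * (1 - exp (- \<theta>)) \<le> 1 * 1" using q \<theta> by (intro mult_mono) auto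
    then show "- 1 \<le> - (?q * (1 - exp (- \<theta>)))" by simp
  qed
  also have "\<dots> \<le> exp (- (\<theta> * (1 - \<theta> / 2) * d * (1 - p * B)) * real s)"
  proof -
    define x where "x = p * real s"
    have x: "0 \<le> x" "x \<le> p * B" using p B by (auto simp: x_def mult_left_mono)
    have "(1 - p) ^ s \<le> exp (- x)"
      using one_plus_power_le_exp[of "- p" s] p by (simp add: x_def mult.commute)
    also have "\<dots> \<le> 1 - x + x\<^sup>2 / 2" by (rule exp_minus_le_quadratic[OF x(1)])
    finally have q_ge: "x * (1 - x / 2) \<le> ?q" by (simp add: power2_eq_square algebra_simps)
    have "p * (n - B) \<le> p * real m" using p B by (intro mult_left_mono) auto
    moreover have "p * B \<le> p * B * d / 2"
      using d p B mult_left_mono[of 2 d "p * B"] by simp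
    ultimately have pm: "d * (1 - p * B / 2) \<le> p * real m"
      using d p by (simp add: algebra_simps)
    have "d * (1 - p * B) * real s \<le> (d * (1 - p * B / 2)) * (1 - x / 2) * real s"
    proof (rule mult_right_mono)
      have "1 - p * B \<le> (1 - p * B / 2) * (1 - p * B / 2)"
        using zero_le_power2[of "p * B / 2"] by (simp add: power2_eq_square algebra_simps)
      also have "\<dots> \<le> (1 - p * B / 2) * (1 - x / 2)"
        using x B by (intro mult_left_mono) auto
      finally have "d * (1 - p * B) \<le> d * ((1 - p * B / 2) * (1 - x / 2))"
        using d by (intro mult_left_mono) auto
      then show "d * (1 - p * B) \<le> d * (1 - p * B / 2) * (1 - x / 2)" by (simp add: mult.assoc)
    qed simp
    also have "\<dots> \<le> p * real m * (1 - x / 2) * real s"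
      using pm x B by (intro mult_right_mono) auto
    also have "\<dots> = real m * (x * (1 - x / 2))" by (simp add: x_def)
    also have "\<dots> \<le> real m * ?q" by (intro mult_left_mono q_ge) auto
    finally have qm: "d * (1 - p * B) * real s \<le> real m * ?q" .
    have "\<theta> * (1 - \<theta> / 2) \<le> 1 - exp (- \<theta>)"
      using exp_minus_le_quadratic[OF \<theta>] by (simp add: power2_eq_square algebra_simps)
    then have "(\<theta> * (1 - \<theta> / 2)) * (d * (1 - p * B) * real s) \<le> (1 - exp (- \<theta>)) * (d * (1 - p * B) * real s)"
      using d B by (intro mult_right_mono) auto
    also have "\<dots> \<le> (1 - exp (- \<theta>)) * (real m * ?q)"
      using qm \<theta> by (intro mult_left_mono) auto
    finally show ?thesis by (simp add: mult_ac)
  qed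
  finally show ?thesis .
qed

lemma expectation_binomial_id:
  fixes q :: real
  assumes q: "0 \<le> q" "q \<le> 1"
  shows "measure_pmf.expectation (binomial_pmf m q) real = real m * q"
proof (induction m)
  case 0
  then show ?case using q by (simp add: binomial_pmf_0)
next
  case (Suc m)
  have "binomial_pmf (Suc m) q = bind_pmf (bernoulli_pmf q)
      (\<lambda>b. map_pmf (\<lambda>k. (if b then 1 else 0) + k) (binomial_pmf m q))"
    using q by (simp add: binomial_pmf_Suc map_pmf_def)
  then have "measure_pmf.expectation (binomial_pmf (Suc m) q) real
      = measure_pmf.expectation (bernoulli_pmf q)
          (\<lambda>b. measure_pmf.expectation (binomial_pmf m q) (\<lambda>k. real ((if b then 1 else 0) + k)))"
    using q by (simp only:) (subst expectation_bind_finite, auto intro!: finite_imageI)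
  also have "\<dots> = real (Suc m) * q"
    using q Suc by (simp add: algebra_simps)
  finally show ?case .
qed

text \<open>
  The error term collects the probabilities that the exploration ever exceeds the size caps \<open>B\<close>;
  below these caps the loss of a step compared to a Galton--Watson process is controlled.
\<close>
lemma chain_lower_mgf:
  fixes p d :: real and \<theta> B :: "nat \<Rightarrow> real"
  assumes p: "0 \<le> p" "p \<le> 1" and d: "2 \<le> d" "d \<le> p * real n" and n: "s + m = n"
    and \<theta>: "\<And>j. j \<le> K \<Longrightarrow> 0 \<le> \<theta> j"
      "\<And>j. j < K \<Longrightarrow> \<theta> (Suc j) \<le> \<theta> j * (1 - \<theta> j / 2) * d * (1 - p * B (K - Suc j))"
    and B: "\<And>l. l < K \<Longrightarrow> p * B l \<le> 1"
    and l: "l \<le> K"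
  shows "measure_pmf.expectation (chain p l s m) (\<lambda>(t, u). exp (- \<theta> (K - l) * real t))
    \<le> exp (- \<theta> K * real s)
      + (\<Sum>j<l. measure_pmf.prob (chain p j s m) {(t, u). B j < real n - real u})"
  using l
proof (induction l)
  case 0
  then show ?case by simp
next
  case (Suc l)
  let ?C = "chain p l s m"
  have fin: "finite (set_pmf ?C)" using p by simp
  let ?A = "{(t :: nat, u). B l < real n - real u}"
  \<comment> \<open>The exponents are indexed by the levels still to come, the caps by the levels
    already explored; hence the reversed index when the last step is split off.\<close>
  have KS: "K - l = Suc (K - Suc l)" using Suc.prems by simp
  have "measure_pmf.expectation (chain p (Suc l) s m) (\<lambda>(t, u). exp (- \<theta> (K - Suc l) * real t))
      = measure_pmf.expectation ?C (\<lambda>(t, u). measure_pmf.expectation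
          (binomial_pmf u (1 - (1 - p) ^ t)) (\<lambda>x. exp (- \<theta> (K - Suc l) * real x)))"
    using expectation_chain_Suc_right[OF p] by simp
  also have "\<dots> \<le> measure_pmf.expectation ?C
      (\<lambda>z. (\<lambda>(t, u). exp (- \<theta> (K - l) * real t)) z + indicator ?A z)"
  proof (rule expectation_mono_finite[OF fin])
    fix z assume "z \<in> set_pmf ?C"
    then obtain t u where z: "z = (t, u)" and tu: "(t, u) \<in> set_pmf ?C" by (cases z) auto
    have le: "t + u \<le> n" using set_chain[OF p tu] n by simp
    let ?E = "measure_pmf.expectation (binomial_pmf u (1 - (1 - p) ^ t))
        (\<lambda>x. exp (- \<theta> (K - Suc l) * real x))"
    have "?E \<le> exp (- \<theta> (K - l) * real t) + indicator ?A (t, u)"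
    proof (cases "B l < real n - real u")
      case True
      have "?E \<le> measure_pmf.expectation (binomial_pmf u (1 - (1 - p) ^ t)) (\<lambda>_. 1)"
        using hit_prob[OF p, of t] \<theta>(1)[of "K - Suc l"] by (intro expectation_mono_finite) auto
      then show ?thesis using True by (simp add: add_increasing)
    next
      case False
      have "?E \<le> exp (- (\<theta> (K - Suc l) * (1 - \<theta> (K - Suc l) / 2) * d * (1 - p * B l)) * real t)"
        using False le p d \<theta>(1)[of "K - Suc l"] B[of l] Suc.prems
        by (intro expectation_binomial_exp_minus_le[where n = "real n"]) auto
      also have "\<dots> \<le> exp (- \<theta> (K - l) * real t)"
      proof -
        have "K - Suc (K - Suc l) = l" "K - Suc l < K" using Suc.prems by auto
        then have "\<theta> (K - l) \<le> \<theta> (K - Suc l) * (1 - \<theta> (K - Suc l) / 2) * d * (1 - p * B l)"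
          using \<theta>(2)[of "K - Suc l"] KS by simp
        then show ?thesis by (simp add: mult_right_mono)
      qed
      finally show ?thesis using False by simp
    qed
    then show "(\<lambda>(t, u). measure_pmf.expectation (binomial_pmf u (1 - (1 - p) ^ t))
          (\<lambda>x. exp (- \<theta> (K - Suc l) * real x))) z
        \<le> (\<lambda>(t, u). exp (- \<theta> (K - l) * real t)) z + indicator ?A z"
      unfolding z by simp
  qed
  also have "\<dots> = measure_pmf.expectation ?C (\<lambda>(t, u). exp (- \<theta> (K - l) * real t))
      + measure_pmf.prob ?C ?A"
    using fin by (subst Bochner_Integration.integral_add) (auto intro: integrable_measure_pmf_finite)
  also have "\<dots> \<le> exp (- \<theta> K * real s)
      + (\<Sum>j<Suc l. measure_pmf.prob (chain p j s m) {(t, u). B j < real n - real u})"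
    using Suc by simp
  finally show ?case .
qed

text \<open>In the last step an unexplored vertex is missed by all \<open>t\<close> frontier
  vertices with probability \<open>(1 - p) ^ t\<close>. The expected number of far vertices is thus
  controlled by the Laplace transform of the frontier at \<open>p\<close>.\<close>

lemma expectation_chain_unreached:
  fixes p :: real
  assumes p: "0 \<le> p" "p \<le> 1"
  shows "measure_pmf.expectation (chain p (Suc k) s m) (\<lambda>(t, u). real u)
    \<le> real m * measure_pmf.expectation (chain p k s m) (\<lambda>(t, u). exp (- p * real t))"
proof -
  let ?C = "chain p k s m"
  have "measure_pmf.expectation (chain p (Suc k) s m) (\<lambda>(t, u). real u)
      = measure_pmf.expectation ?C (\<lambda>(t, u). measure_pmf.expectation
          (binomial_pmf u (1 - (1 - p) ^ t)) (\<lambda>x. real (u - x)))"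
    using expectation_chain_Suc_right[OF p] by simp
  also have "\<dots> \<le> measure_pmf.expectation ?C (\<lambda>z. real m * (\<lambda>(t, u). exp (- p * real t)) z)"
  proof (rule expectation_mono_finite)
    fix z assume "z \<in> set_pmf ?C"
    then obtain t u where z: "z = (t, u)" and u: "u \<le> m"
      using set_chain[OF p, of _ _ k s m] by (cases z) blast
    let ?M = "binomial_pmf u (1 - (1 - p) ^ t)"
    have q: "0 \<le> 1 - (1 - p) ^ t" "1 - (1 - p) ^ t \<le> 1" using hit_prob[OF p] by auto
    then have "measure_pmf.expectation ?M (\<lambda>x. real (u - x))
        \<le> measure_pmf.expectation ?M (\<lambda>x. real u - real x)"
      using set_binomial_pmf_subset[OF q] by (intro expectation_mono_finite) fastforce+
    also have "\<dots> = real u * (1 - p) ^ t"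
      using q by (subst Bochner_Integration.integral_diff)
        (auto simp: expectation_binomial_id algebra_simps)
    also have "\<dots> \<le> real m * exp (- p * real t)"
      using one_plus_power_le_exp[of "- p" t] p u
      by (intro mult_mono) (auto simp: mult.commute)
    finally show "(\<lambda>(t, u). measure_pmf.expectation (binomial_pmf u (1 - (1 - p) ^ t))
        (\<lambda>x. real (u - x))) z \<le> real m * (\<lambda>(t, u). exp (- p * real t)) z"
      unfolding z by simp
  qed (use p in simp)
  finally show ?thesis by simp
qed

text \<open>
  The weights \<open>1 - 10 p (d ^ j d ^ (k - 1 - j) - d ^ (k - 1 - j) + d ^ j / d)\<close> decrease just
  fast enough to absorb the losses \<open>\<theta> j / 2\<close> (second order term) and \<open>5 p d ^ (k - 1 - j)\<close>
  (vertices already explored).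
\<close>
lemma expected_unreached_le:
  fixes p d \<mu> :: real
  assumes p: "0 \<le> p" "p \<le> 1" and d: "2 \<le> d" and dn: "d = p * (real n - 1)" and k: "1 \<le> k"
    and \<mu>: "0 < \<mu>" "exp ((2 + 4 * \<mu>) / d) \<le> 2"
    and \<sigma>: "20 * p * d ^ (k - 1) \<le> 1"
  shows "measure_pmf.expectation (chain p (Suc k) 1 (n - 1)) (\<lambda>(t, u). real u)
    \<le> real n * (exp (- p * d ^ k * (1 - 20 * p * d ^ (k - 1))) + real k * exp (- 3 * \<mu>))"
proof -
  have n: "n \<ge> 1" using d dn p by (cases n) auto
  define w where "w j = 1 - 10 * p * (d ^ (k - 1) - d ^ (k - 1) / d ^ j + d ^ j / d)" for j
  define \<theta> where "\<theta> j = p * d ^ j * w j" for j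
  \<comment> \<open>The factor 5 leaves room in \<open>chain_growth_tail\<close>: its exponential is
    at most 2, so exceeding a cap has probability at most \<open>exp (- 3 * \<mu>)\<close>.\<close>
  define B where "B l = 5 * d ^ l" for l :: nat
  have pow: "1 \<le> d ^ j" for j using d by simp
  have w: "0 \<le> w j" "w j \<le> 1" "1 - 20 * p * d ^ (k - 1) \<le> w j" if "j \<le> k" for j
  proof -
    have "d * d ^ (k - 1) = d ^ k" using k by (cases k) auto
    moreover have "d ^ j \<le> d ^ k" using that d by (intro power_increasing) auto
    ultimately have "d ^ j \<le> d * d ^ (k - 1)" by simp
    then have le: "d ^ j / d \<le> d ^ (k - 1)" using d by (simp add: field_simps)
    have le2: "d ^ (k - 1) / d ^ j \<le> d ^ (k - 1)" "0 \<le> d ^ (k - 1) / d ^ j" "0 \<le> d ^ j / d"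
      using pow[of j] d by (auto simp: field_simps)
    have "10 * p * (d ^ (k - 1) - d ^ (k - 1) / d ^ j + d ^ j / d) \<le> 10 * p * (2 * d ^ (k - 1))"
      using le le2 p by (intro mult_left_mono) auto
    then show "1 - 20 * p * d ^ (k - 1) \<le> w j" by (simp add: w_def)
    then show "0 \<le> w j" using \<sigma> by simp
    have "0 \<le> 10 * p * (d ^ (k - 1) - d ^ (k - 1) / d ^ j + d ^ j / d)"
      using le2 p by (intro mult_nonneg_nonneg) auto
    then show "w j \<le> 1" by (simp add: w_def)
  qed
  have pB: "p * B l \<le> 1" if "l < k" for l
  proof -
    have "d ^ l \<le> d ^ (k - 1)" using that d by (intro power_increasing) auto
    then have "p * d ^ l \<le> p * d ^ (k - 1)" using p by (intro mult_left_mono) auto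
    then show ?thesis using \<sigma> p d by (simp add: B_def)
  qed
  have \<theta>_nonneg: "0 \<le> \<theta> j" if "j \<le> k" for j
    using w[OF that] p d by (simp add: \<theta>_def)
  have step: "\<theta> (Suc j) \<le> \<theta> j * (1 - \<theta> j / 2) * d * (1 - p * B (k - Suc j))" if j: "j < k" for j
  proof -
    define X Y where "X = d ^ j" and "Y = d ^ (k - Suc j)"
    have XY: "d ^ (k - 1) = X * Y"
      using j by (simp add: X_def Y_def power_add[symmetric])
    have X: "1 \<le> X" "1 \<le> Y" by (simp_all add: X_def Y_def pow)
    have wj: "w j = 1 - 10 * p * (X * Y - Y + X / d)"
      unfolding w_def XY using X by (simp add: X_def[symmetric])
    have wSj: "w (Suc j) = 1 - 10 * p * (X * Y - Y / d + X)"
      unfolding w_def XY using X d by (simp add: X_def[symmetric])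
    have "p * (X + Y) * (1 / 2) \<le> p * (X + Y) * (1 - 1 / d)"
      using p X d by (intro mult_left_mono) (auto simp: field_simps)
    moreover have "w j - w (Suc j) = 10 * (p * (X + Y) * (1 - 1 / d))"
      unfolding wj wSj by (simp add: algebra_simps)
    moreover have "5 * p * (X + Y) = 10 * (p * (X + Y) * (1 / 2))" by simp
    ultimately have drop: "w (Suc j) \<le> w j - 5 * p * (X + Y)" by linarith
    have wb: "0 \<le> w j" "w j \<le> 1" using w[of j] j by auto
    have \<theta>j: "\<theta> j = p * X * w j" by (simp add: \<theta>_def X_def)
    have BY: "p * B (k - Suc j) = 5 * p * Y" by (simp add: B_def Y_def)
    have "\<theta> j \<le> p * X * 1" unfolding \<theta>j using wb p X by (intro mult_left_mono) auto
    moreover have "0 \<le> p * X" using p X by simp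
    ultimately have "\<theta> j / 2 + 5 * p * Y \<le> 5 * p * (X + Y)" by (simp add: algebra_simps)
    then have "w (Suc j) \<le> w j - (\<theta> j / 2 + 5 * p * Y)" using drop by simp
    also have "\<dots> \<le> w j - w j * (\<theta> j / 2 + 5 * p * Y)"
      using wb \<theta>_nonneg[of j] j p X mult_right_mono[of "w j" 1 "\<theta> j / 2 + 5 * p * Y"] by simp
    also have "\<dots> \<le> w j * (1 - \<theta> j / 2) * (1 - 5 * p * Y)"
    proof -
      have "0 \<le> w j * (\<theta> j / 2 * (5 * p * Y))"
        using wb \<theta>_nonneg[of j] j p X by (intro mult_nonneg_nonneg) auto
      then show ?thesis by (simp add: algebra_simps)
    qed
    finally have "(p * X * d) * w (Suc j) \<le> (p * X * d) * (w j * (1 - \<theta> j / 2) * (1 - 5 * p * Y))"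
      using p X d by (intro mult_left_mono) auto
    then show ?thesis unfolding BY
      by (simp add: \<theta>_def[of "Suc j"] \<theta>j X_def[symmetric] mult_ac)
  qed
  have prob: "measure_pmf.prob (chain p j 1 (n - 1)) {(t, u). B j < real n - real u}
      \<le> exp (- 3 * \<mu>)" for j
  proof -
    have "measure_pmf.prob (chain p j 1 (n - 1)) {(t, u). B j < real n - real u}
        = measure_pmf.prob (chain p j 1 (n - 1))
            {(t, u). 5 * d ^ j < real 1 + real (n - 1) - real u}"
      using n by (simp add: B_def of_nat_diff)
    also have "\<dots> \<le> exp (\<mu> * (real 1 * exp ((2 + 4 * \<mu>) / d) - 5))"
      using p d dn \<mu> n by (intro chain_growth_tail) (auto simp: of_nat_diff)
    also have "\<dots> \<le> exp (- 3 * \<mu>)"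
    proof -
      have "\<mu> * (exp ((2 + 4 * \<mu>) / d) - 5) \<le> \<mu> * (- 3)"
        using \<mu> by (intro mult_left_mono) auto
      then show ?thesis by simp
    qed
    finally show ?thesis .
  qed
  have "measure_pmf.expectation (chain p k 1 (n - 1)) (\<lambda>(t, u). exp (- \<theta> (k - k) * real t))
      \<le> exp (- \<theta> k * real 1)
        + (\<Sum>j<k. measure_pmf.prob (chain p j 1 (n - 1)) {(t, u). B j < real n - real u})"
  proof (rule chain_lower_mgf[where d = d])
    show "d \<le> p * real n" using dn p by (simp add: algebra_simps)
  qed (use p d n \<theta>_nonneg step pB in auto)
  also have "\<dots> \<le> exp (- \<theta> k * real 1) + (\<Sum>j<k. exp (- 3 * \<mu>))"
    by (intro add_left_mono sum_mono prob)
  also have "\<dots> \<le> exp (- p * d ^ k * (1 - 20 * p * d ^ (k - 1))) + real k * exp (- 3 * \<mu>)"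
  proof -
    have "p * d ^ k * (1 - 20 * p * d ^ (k - 1)) \<le> \<theta> k"
      unfolding \<theta>_def using w(3)[of k] p d by (intro mult_left_mono) auto
    then show ?thesis by simp
  qed
  finally have "measure_pmf.expectation (chain p k 1 (n - 1)) (\<lambda>(t, u). exp (- \<theta> 0 * real t))
      \<le> exp (- p * d ^ k * (1 - 20 * p * d ^ (k - 1))) + real k * exp (- 3 * \<mu>)"
    by simp
  moreover have "\<theta> 0 = p * w 0" by (simp add: \<theta>_def)
  \<comment> \<open>The covering step supplies the exponent \<open>p\<close>, while the recursion
    starts at \<open>\<theta> 0 = p * w 0\<close>. As \<open>w 0 \<le> 1\<close>, replacing
    \<open>p\<close> by \<open>\<theta> 0\<close> only enlarges the transform.\<close>
  moreover have "measure_pmf.expectation (chain p k 1 (n - 1)) (\<lambda>(t, u). exp (- p * real t))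
      \<le> measure_pmf.expectation (chain p k 1 (n - 1)) (\<lambda>(t, u). exp (- \<theta> 0 * real t))"
  proof (rule expectation_mono_finite)
    have "p * w 0 \<le> p * 1" using w[of 0] p by (intro mult_left_mono) auto
    then have "\<theta> 0 * real t \<le> p * real t" for t
      by (intro mult_right_mono) (auto simp: \<theta>_def)
    then show "(\<lambda>(t, u). exp (- p * real t)) z \<le> (\<lambda>(t, u). exp (- \<theta> 0 * real t)) z"
      for z :: "nat \<times> nat" by (cases z) simp
  qed (use p in simp)
  ultimately have "measure_pmf.expectation (chain p k 1 (n - 1)) (\<lambda>(t, u). exp (- p * real t))
      \<le> exp (- p * d ^ k * (1 - 20 * p * d ^ (k - 1))) + real k * exp (- 3 * \<mu>)"
    by linarith
  then have "real (n - 1) * measure_pmf.expectation (chain p k 1 (n - 1)) (\<lambda>(t, u). exp (- p * real t))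
      \<le> real n * (exp (- p * d ^ k * (1 - 20 * p * d ^ (k - 1))) + real k * exp (- 3 * \<mu>))"
    by (intro mult_mono Bochner_Integration.integral_nonneg) (auto simp: case_prod_unfold)
  then show ?thesis using expectation_chain_unreached[OF p, of k 1 "n - 1"] by linarith
qed

text \<open>The remaining \<open>u - x\<close> vertices form a binomial variable with mean
  \<open>u * (1 - p) ^ t\<close>. Chernoff's bound with parameter 1 gives the factor
  \<open>1 - exp (- 1)\<close>, which exceeds \<open>1 / 2\<close>.\<close>

lemma prob_binomial_few_left_le:
  fixes p L :: real
  assumes p: "0 \<le> p" "p < 1"
  shows "measure_pmf.prob (binomial_pmf u (1 - (1 - p) ^ t)) {x. real u - real x \<le> L}
    \<le> exp (L - real u * (1 - p) ^ t / 2)"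
proof -
  let ?q = "1 - (1 - p) ^ t"
  let ?M = "binomial_pmf u ?q"
  have q: "0 \<le> ?q" "?q \<le> 1" using hit_prob[of p t] p by auto
  have "measure_pmf.prob ?M {x. real u - real x \<le> L}
      \<le> measure_pmf.expectation ?M (\<lambda>x. exp (L - real u) * exp 1 ^ x)"
    using q by (intro prob_le_expectation) (auto simp: exp_of_nat_mult[symmetric] exp_add[symmetric])
  also have "\<dots> = exp (L - real u) * (1 - ?q + ?q * exp 1) ^ u"
    using expectation_binomial_power[OF q, of u "exp 1"] by simp
  also have "\<dots> = exp L * (exp (- 1) * (1 - ?q + ?q * exp 1)) ^ u"
    unfolding power_mult_distrib exp_of_nat_mult[symmetric] by (simp add: exp_diff exp_minus field_simps)
  also have "exp (- 1) * (1 - ?q + ?q * exp 1) = 1 + (- (1 - exp (- 1)) * (1 - p) ^ t)"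
    by (simp add: algebra_simps exp_add[symmetric])
  also have "exp L * (1 + (- (1 - exp (- 1)) * (1 - p) ^ t)) ^ u
      \<le> exp L * exp (real u * (- (1 - exp (- 1)) * (1 - p) ^ t))"
  proof (intro mult_left_mono one_plus_power_le_exp)
    have "(1 - exp (- 1 :: real)) * (1 - p) ^ t \<le> 1 * 1"
      using p by (intro mult_mono power_le_one) auto
    moreover have "- (1 - exp (- 1)) * (1 - p) ^ t = - ((1 - exp (- 1)) * (1 - p) ^ t)"
      by (rule mult_minus_left)
    ultimately show "- 1 \<le> - (1 - exp (- 1)) * (1 - p) ^ t" by linarith
  qed simp
  also have "\<dots> \<le> exp (L - real u * (1 - p) ^ t / 2)"
  proof -
    have "2 \<le> exp (1 :: real)" using exp_ge_add_one_self[of 1] by simp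
    then have "1 / 2 \<le> 1 - exp (- 1 :: real)" by (simp add: exp_minus field_simps)
    then have "1 / 2 * (real u * (1 - p) ^ t) \<le> (1 - exp (- 1)) * (real u * (1 - p) ^ t)"
      using p by (intro mult_right_mono) auto
    then show ?thesis by (simp add: exp_add[symmetric] algebra_simps)
  qed
  finally show ?thesis .
qed

text \<open>If the \<open>k\<close>-ball has at most \<open>B\<close> vertices, then at least
  \<open>s + m - B\<close> are unexplored and at most \<open>B\<close> lie in the frontier. Each
  unexplored vertex then survives with probability at least \<open>exp (- p * B / (1 - p))\<close>,
  because \<open>1 - p \<ge> exp (- p / (1 - p))\<close>.\<close>

lemma prob_few_unreached_le:
  fixes p L B :: real
  assumes p: "0 \<le> p" "p < 1" and B: "0 \<le> B" "B \<le> real s + real m"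
  shows "measure_pmf.prob (chain p (Suc k) s m) {(t, u). real u \<le> L}
    \<le> measure_pmf.prob (chain p k s m) {(t, u). B < real s + real m - real u}
      + exp (L - (real s + real m - B) * exp (- p * B / (1 - p)) / 2)"
proof -
  have p1: "p \<le> 1" using p by simp
  let ?C = "chain p k s m"
  let ?A = "{(t :: nat, u :: nat). real u \<le> L}"
  let ?G = "{(t :: nat, u). B < real s + real m - real u}"
  let ?b = "exp (L - (real s + real m - B) * exp (- p * B / (1 - p)) / 2)"
  have fin: "finite (set_pmf ?C)" using p by simp
  have "measure_pmf.prob (chain p (Suc k) s m) ?A
      = measure_pmf.expectation (chain p (Suc k) s m) (indicator ?A)" by simp
  also have "\<dots> = measure_pmf.expectation ?C (\<lambda>(t, u). measure_pmf.expectation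
        (binomial_pmf u (1 - (1 - p) ^ t)) (\<lambda>x. indicator ?A (x, u - x)))"
    by (rule expectation_chain_Suc_right[OF p(1) p1])
  also have "\<dots> \<le> measure_pmf.expectation ?C (\<lambda>z. indicator ?G z + ?b)"
  proof (rule expectation_mono_finite[OF fin])
    fix z assume "z \<in> set_pmf ?C"
    then obtain t u where z: "z = (t, u)" and tu: "(t, u) \<in> set_pmf ?C" by (cases z) auto
    have le: "t + u \<le> s + m" using set_chain[OF p(1) p1 tu] by simp
    let ?M = "binomial_pmf u (1 - (1 - p) ^ t)"
    let ?E = "measure_pmf.expectation ?M (\<lambda>x. indicator ?A (x, u - x)) :: real"
    have finM: "finite (set_pmf ?M)" using hit_prob[OF p(1) p1, of t] by auto
    have "?E \<le> indicator ?G (t, u) + ?b"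
    proof (cases "B < real s + real m - real u")
      case True
      have "?E \<le> measure_pmf.expectation ?M (\<lambda>_. 1)"
        by (intro expectation_mono_finite[OF finM]) (auto simp: indicator_def)
      then show ?thesis using True by (simp add: add_increasing2)
    next
      case False
      have "?E \<le> measure_pmf.expectation ?M (indicator {x. real u - real x \<le> L})"
        by (intro expectation_mono_finite[OF finM]) (auto simp: indicator_def)
      also have "\<dots> \<le> exp (L - real u * (1 - p) ^ t / 2)"
        using prob_binomial_few_left_le[OF p, of u t L] by simp
      also have "\<dots> \<le> ?b"
      proof -
        have "exp (- p * B / (1 - p)) \<le> exp (- p * real t / (1 - p))"
          using False le p by (auto intro!: divide_right_mono mult_left_mono)
        also have "\<dots> = exp (- (p / (1 - p))) ^ t"
          by (simp add: exp_of_nat_mult[symmetric] mult.commute)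
        also have "\<dots> \<le> (1 - p) ^ t"
        proof (rule power_mono)
          have "1 + p / (1 - p) \<le> exp (p / (1 - p))" by (rule exp_ge_add_one_self)
          then show "exp (- (p / (1 - p))) \<le> 1 - p"
            using p by (simp add: exp_minus field_simps)
        qed simp
        finally have "(real s + real m - B) * exp (- p * B / (1 - p)) \<le> real u * (1 - p) ^ t"
          using False B by (intro mult_mono) auto
        then show ?thesis by simp
      qed
      finally show ?thesis using False by simp
    qed
    then show "(\<lambda>(t, u). measure_pmf.expectation (binomial_pmf u (1 - (1 - p) ^ t))
        (\<lambda>x. indicator ?A (x, u - x))) z \<le> indicator ?G z + ?b"
      unfolding z by simp
  qed
  also have "\<dots> = measure_pmf.prob ?C ?G + ?b"
    using fin by (subst Bochner_Integration.integral_add) (auto intro: integrable_measure_pmf_finite)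
  finally show ?thesis .
qed

section \<open>Union bounds in the random graph\<close>

lemma prob_exists_subset_le:
  fixes b :: real
  assumes b: "0 \<le> b" and r: "r \<le> n"
    and le: "\<And>R. R \<subseteq> {1..n} \<Longrightarrow> card R = r \<Longrightarrow> measure_pmf.prob M {f. Q R f} \<le> b"
  shows "measure_pmf.prob M {f. \<exists>R. R \<subseteq> {1..n} \<and> card R = r \<and> Q R f} \<le> real n ^ r * b"
proof -
  let ?F = "{R. R \<subseteq> {1..n} \<and> card R = r}"
  have fin: "finite ?F" by (rule finite_subset[of _ "Pow {1..n}"]) auto
  have "{f. \<exists>R. R \<subseteq> {1..n} \<and> card R = r \<and> Q R f} = (\<Union>R\<in>?F. {f. Q R f})" by auto
  then have "measure_pmf.prob M {f. \<exists>R. R \<subseteq> {1..n} \<and> card R = r \<and> Q R f}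
      \<le> (\<Sum>R\<in>?F. measure_pmf.prob M {f. Q R f})"
    using fin by (simp add: measure_pmf.finite_measure_subadditive_finite)
  also have "\<dots> \<le> (\<Sum>R\<in>?F. b)" using le by (intro sum_mono) auto
  also have "\<dots> = real (n choose r) * b" by (simp add: n_subsets)
  also have "\<dots> \<le> real n ^ r * b"
    using binomial_le_pow[OF r] b by (intro mult_right_mono) (auto simp flip: of_nat_power)
  finally show ?thesis .
qed

text \<open>The absence of crossing edges means that the first exploration step discovers nothing,
  so the law of the exploration already contains this probability.\<close>

lemma prob_no_crossing_edge:
  fixes p :: real
  assumes S: "S \<subseteq> {1..n}" "2 * card S \<le> n" and n: "1 \<le> n" and p: "0 \<le> p" "p \<le> 1"
  shows "measure_pmf.prob (edges_pmf (vertex_pairs n) p) {f. \<forall>s\<in>S. \<forall>u\<in>{1..n} - S. \<not> f {s, u}}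
    \<le> exp (- p * real n / 2) ^ card S"
proof -
  let ?s = "card S"
  let ?m = "n - ?s"
  let ?M = "edges_pmf (vertex_pairs n) p"
  have m: "?m > 0" using S n by simp
  have q: "0 \<le> 1 - (1 - p) ^ ?s" "1 - (1 - p) ^ ?s \<le> 1" using hit_prob[OF p] by auto
  have fin: "finite S" using S finite_subset by blast
  have "measure_pmf.prob ?M {f. \<forall>s\<in>S. \<forall>u\<in>{1..n} - S. \<not> f {s, u}}
      \<le> measure_pmf.prob ?M {f. card (unreached 1 f S ({1..n} - S)) = ?m}"
  proof (rule measure_pmf.finite_measure_mono)
    have "card (unreached 1 f S ({1..n} - S)) = ?m"
      if "\<forall>s\<in>S. \<forall>u\<in>{1..n} - S. \<not> f {s, u}" for f
    proof -
      have "discovered f S ({1..n} - S) = {}" using that by (auto simp: discovered_def)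
      then show ?thesis using S fin by (simp add: card_Diff_subset)
    qed
    then show "{f. \<forall>s\<in>S. \<forall>u\<in>{1..n} - S. \<not> f {s, u}}
        \<subseteq> {f. card (unreached 1 f S ({1..n} - S)) = ?m}" by auto
  qed simp
  also have "\<dots> = measure_pmf.prob (map_pmf (\<lambda>f. card (unreached 1 f S ({1..n} - S))) ?M) {?m}"
    by (simp add: vimage_def)
  also have "\<dots> = measure_pmf.prob (map_pmf snd (chain p 1 ?s ?m)) {?m}"
    by (simp only: unreached_law[OF S(1) p])
  also have "\<dots> = measure_pmf.prob (binomial_pmf ?m (1 - (1 - p) ^ ?s)) ((\<lambda>t. ?m - t) -` {?m})"
    by (simp add: map_pmf_def[symmetric] map_pmf_comp)
  also have "(\<lambda>t. ?m - t) -` {?m} = {0}" using m by auto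
  also have "measure_pmf.prob (binomial_pmf ?m (1 - (1 - p) ^ ?s)) {0} = ((1 - p) ^ ?s) ^ ?m"
    using q by (simp add: measure_pmf_single)
  also have "\<dots> \<le> (exp (- p * real n / 2)) ^ ?s"
  proof -
    have "(1 - p) ^ (?s * ?m) \<le> exp (real (?s * ?m) * (- p))"
      using one_plus_power_le_exp[of "- p" "?s * ?m"] p by simp
    also have "\<dots> \<le> exp (real ?s * (- p * real n / 2))"
    proof -
      have "real n / 2 \<le> real ?m" using S by linarith
      then have "real ?s * p * (real n / 2) \<le> real ?s * p * real ?m"
        using p by (intro mult_left_mono) auto
      then show ?thesis by (simp add: mult_ac)
    qed
    finally show ?thesis by (simp only: power_mult exp_of_nat_mult)
  qed
  finally show ?thesis .
qed

text \<open>Cuts of size \<open>j\<close> contribute at most the \<open>j\<close>-th power of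
  \<open>y = n * exp (- p * n / 2)\<close>. If \<open>y \<le> 1\<close>, each of the
  \<open>n\<close> sizes costs at most \<open>y\<close>; otherwise the claimed bound is at least
  1.\<close>

lemma prob_disconnected_le:
  fixes p :: real
  assumes n: "1 \<le> n" and p: "0 \<le> p" "p \<le> 1"
  shows "measure_pmf.prob (edges_pmf (vertex_pairs n) p)
      {f. \<not> Digraph_Component.connected (with_proj (edge_graph n f))}
    \<le> (real n)\<^sup>2 * exp (- p * real n / 2)"
proof (cases "real n * exp (- p * real n / 2) \<le> 1")
  case False
  have "1 \<le> real n * (real n * exp (- p * real n / 2))"
    using False n mult_mono[of 1 "real n" 1 "real n * exp (- p * real n / 2)"] by simp
  then show ?thesis
    by (intro order_trans[OF measure_pmf.prob_le_1]) (simp add: power2_eq_square mult.assoc)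
next
  case True
  let ?M = "edges_pmf (vertex_pairs n) p"
  let ?y = "exp (- p * real n / 2)"
  let ?cut = "\<lambda>S f. 2 * card S \<le> n \<and> (\<forall>s\<in>S. \<forall>u\<in>{1..n} - S. \<not> f {s, u})"
  let ?A = "\<lambda>j. {f. \<exists>S. S \<subseteq> {1..n} \<and> card S = j \<and> ?cut S f}"
  have "{f. \<not> Digraph_Component.connected (with_proj (edge_graph n f))} \<subseteq> (\<Union>j\<in>{1..n}. ?A j)"
  proof
    fix f assume "f \<in> {f. \<not> Digraph_Component.connected (with_proj (edge_graph n f))}"
    then obtain S where S: "S \<subseteq> {1..n}" "S \<noteq> {}" "?cut S f"
      using connected_edge_graph[OF n, of f] by blast
    have "finite S" using S finite_subset by blast
    then have "card S \<in> {1..n}" using S card_mono[of "{1..n}" S] by (auto simp: Suc_le_eq card_gt_0_iff)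
    then show "f \<in> (\<Union>j\<in>{1..n}. ?A j)" using S by blast
  qed
  then have "measure_pmf.prob ?M {f. \<not> Digraph_Component.connected (with_proj (edge_graph n f))}
      \<le> measure_pmf.prob ?M (\<Union>j\<in>{1..n}. ?A j)"
    by (intro measure_pmf.finite_measure_mono) auto
  also have "\<dots> \<le> (\<Sum>j\<in>{1..n}. measure_pmf.prob ?M (?A j))"
    by (intro measure_pmf.finite_measure_subadditive_finite) auto
  also have "\<dots> \<le> (\<Sum>j\<in>{1..n}. real n * ?y)"
  proof (rule sum_mono)
    fix j assume j: "j \<in> {1..n}"
    have "measure_pmf.prob ?M (?A j) \<le> real n ^ j * ?y ^ j"
    proof (rule prob_exists_subset_le)
      fix S assume S: "S \<subseteq> {1..n}" "card S = j"
      show "measure_pmf.prob ?M {f. ?cut S f} \<le> ?y ^ j"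
      proof (cases "2 * card S \<le> n")
        case True
        then show ?thesis using prob_no_crossing_edge[OF S(1) _ n p] S by simp
      qed simp
    qed (use j in auto)
    also have "\<dots> = (real n * ?y) ^ j" by (simp add: power_mult_distrib)
    also have "\<dots> \<le> (real n * ?y) ^ 1"
      using True j by (intro power_decreasing) auto
    finally show "measure_pmf.prob ?M (?A j) \<le> real n * ?y" by simp
  qed
  also have "\<dots> = (real n)\<^sup>2 * ?y" by (simp add: power2_eq_square)
  finally show ?thesis .
qed

lemma prob_many_far_le:
  fixes p L :: real
  assumes L: "0 < L" and p: "0 \<le> p" "p \<le> 1"
  shows "measure_pmf.prob (edges_pmf (vertex_pairs n) p)
      {f. L \<le> real (\<Sum>u\<in>{1..n}. card (unreached k f {u} ({1..n} - {u})))}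
    \<le> real n * measure_pmf.expectation (chain p k 1 (n - 1)) (\<lambda>(t, u). real u) / L"
proof -
  let ?M = "edges_pmf (vertex_pairs n) p"
  let ?X = "\<lambda>u f. real (card (unreached k f {u} ({1..n} - {u})))"
  have fin: "finite (set_pmf ?M)"
    by (rule finite_subset[OF set_Pi_pmf_subset']) (auto simp: vertex_pairs_eq)
  have exp: "measure_pmf.expectation ?M (?X u)
      = measure_pmf.expectation (chain p k 1 (n - 1)) (\<lambda>(t, u). real u)" if "u \<in> {1..n}" for u
  proof -
    have "measure_pmf.expectation ?M (?X u)
        = measure_pmf.expectation (map_pmf (\<lambda>f. card (unreached k f {u} ({1..n} - {u}))) ?M) real"
      by simp
    also have "\<dots> = measure_pmf.expectation (map_pmf snd (chain p k (card {u}) (n - card {u}))) real"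
      using that p by (subst unreached_law) auto
    finally show ?thesis by (simp add: case_prod_unfold)
  qed
  have "measure_pmf.prob ?M {f. L \<le> real (\<Sum>u\<in>{1..n}. card (unreached k f {u} ({1..n} - {u})))}
      \<le> measure_pmf.expectation ?M (\<lambda>f. (\<Sum>u\<in>{1..n}. ?X u f) / L)"
    using L by (intro prob_le_expectation[OF fin]) (auto simp: sum_nonneg)
  also have "\<dots> = (\<Sum>u\<in>{1..n}. measure_pmf.expectation ?M (?X u)) / L"
    using fin by (simp add: integrable_measure_pmf_finite)
  also have "\<dots> = real n * measure_pmf.expectation (chain p k 1 (n - 1)) (\<lambda>(t, u). real u) / L"
    using exp by simp
  finally show ?thesis .
qed

lemma prob_few_unreached_graph:
  fixes p L :: real
  assumes "R \<subseteq> {1..n}" "0 \<le> p" "p \<le> 1"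
  shows "measure_pmf.prob (edges_pmf (vertex_pairs n) p)
      {f. real (card (unreached k f R ({1..n} - R))) \<le> L}
    = measure_pmf.prob (chain p k (card R) (n - card R)) {(t, u). real u \<le> L}"
proof -
  have "measure_pmf.prob (edges_pmf (vertex_pairs n) p)
      {f. real (card (unreached k f R ({1..n} - R))) \<le> L}
    = measure_pmf.prob (map_pmf (\<lambda>f. card (unreached k f R ({1..n} - R)))
        (edges_pmf (vertex_pairs n) p)) {u. real u \<le> L}"
    by (simp add: vimage_def)
  also have "\<dots> = measure_pmf.prob (map_pmf snd (chain p k (card R) (n - card R))) {u. real u \<le> L}"
    by (simp only: unreached_law[OF assms])
  finally show ?thesis by (simp add: vimage_def case_prod_unfold)
qed

text \<open>Outside three bad events (disconnected, at least \<open>L\<close> far pairs, some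
  \<open>R\<close> that misses at most \<open>L + 2\<close> vertices) every \<open>R\<close> of size
  \<open>r\<close> still misses two vertices after all endpoints of far pairs are removed. The extra
  2 in \<open>L + 2\<close> provides them.\<close>

lemma gnp_metric_dim_gt:
  fixes p L b1 b2 b3 :: real
  assumes n: "1 \<le> n" and p: "0 \<le> p" "p \<le> 1" and r: "r \<le> n" and L: "0 < L" and b3: "0 \<le> b3"
    and conn: "(real n)\<^sup>2 * exp (- p * real n / 2) \<le> b1"
    and far: "real n * measure_pmf.expectation (chain p (Suc k) 1 (n - 1)) (\<lambda>(t, u). real u) / L \<le> b2"
    and few: "measure_pmf.prob (chain p k r (n - r)) {(t, u). real u \<le> L + 2} \<le> b3"
  shows "1 - (b1 + b2 + real n ^ r * b3) \<le> measure_pmf.prob (gnp n p)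
    {G. Digraph_Component.connected (with_proj G) \<and> r < metric_dim (with_proj G)}"
proof -
  let ?M = "edges_pmf (vertex_pairs n) p"
  let ?A = "{f. \<not> Digraph_Component.connected (with_proj (edge_graph n f))}"
  let ?B = "{f. L \<le> real (\<Sum>u\<in>{1..n}. card (unreached (Suc k) f {u} ({1..n} - {u})))}"
  let ?C = "{f. \<exists>R. R \<subseteq> {1..n} \<and> card R = r
                \<and> real (card (unreached k f R ({1..n} - R))) \<le> L + 2}"
  let ?G = "{f. Digraph_Component.connected (with_proj (edge_graph n f))
                \<and> r < metric_dim (with_proj (edge_graph n f))}"
  have "- ?G \<subseteq> ?A \<union> ?B \<union> ?C"
  proof (rule subsetI, rule ccontr)
    fix f assume f: "f \<in> - ?G" "f \<notin> ?A \<union> ?B \<union> ?C"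
    have "r < metric_dim (with_proj (edge_graph n f))"
    proof (rule metric_dim_gt[OF r])
      fix R assume R: "R \<subseteq> {1..n}" "card R = r"
      have "real (\<Sum>u\<in>{1..n}. card (unreached (Suc k) f {u} ({1..n} - {u}))) < L"
        "L + 2 < real (card (unreached k f R ({1..n} - R)))"
        using f(2) R by (auto simp: not_le)
      then have "(\<Sum>u\<in>{1..n}. card (unreached (Suc k) f {u} ({1..n} - {u}))) + 2
          \<le> card (unreached k f R ({1..n} - R))"
        by linarith
      then show "\<not> resolving (with_proj (edge_graph n f)) R"
        by (rule not_resolving_of_unreached[OF R(1)])
    qed
    then show False using f by auto
  qed
  then have "measure_pmf.prob ?M (- ?G) \<le> measure_pmf.prob ?M (?A \<union> ?B \<union> ?C)"
    by (intro measure_pmf.finite_measure_mono) auto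
  also have "\<dots> \<le> measure_pmf.prob ?M ?A + measure_pmf.prob ?M ?B + measure_pmf.prob ?M ?C"
    using measure_Un_le[of "?A \<union> ?B" "measure_pmf ?M" ?C]
      measure_Un_le[of ?A "measure_pmf ?M" ?B] by simp
  also have "\<dots> \<le> b1 + b2 + real n ^ r * b3"
  proof (intro add_mono)
    show "measure_pmf.prob ?M ?A \<le> b1"
      using prob_disconnected_le[OF n p] conn by linarith
    show "measure_pmf.prob ?M ?B \<le> b2"
      using prob_many_far_le[OF L p, where k = "Suc k" and n = n] far by linarith
    show "measure_pmf.prob ?M ?C \<le> real n ^ r * b3"
      using prob_few_unreached_graph[OF _ p, of _ n k "L + 2"] few
      by (intro prob_exists_subset_le[OF b3 r]) auto
  qed
  finally have "measure_pmf.prob ?M (- ?G) \<le> b1 + b2 + real n ^ r * b3" .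
  moreover have "measure_pmf.prob ?M (- ?G) = 1 - measure_pmf.prob ?M ?G"
    using measure_pmf.prob_compl[of ?G ?M] by (simp add: Compl_eq_Diff_UNIV)
  moreover have "measure_pmf.prob (gnp n p)
      {G. Digraph_Component.connected (with_proj G) \<and> r < metric_dim (with_proj G)}
      = measure_pmf.prob ?M ?G"
    by (simp add: gnp_def vimage_def)
  ultimately show ?thesis by linarith
qed

lemma gnp_connected_prob:
  fixes p :: real
  assumes "1 \<le> n" "0 \<le> p" "p \<le> 1"
  shows "1 - (real n)\<^sup>2 * exp (- p * real n / 2)
    \<le> measure_pmf.prob (gnp n p) {G. Digraph_Component.connected (with_proj G)}"
proof -
  let ?M = "edges_pmf (vertex_pairs n) p"
  let ?G = "{f. Digraph_Component.connected (with_proj (edge_graph n f))}"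
  have "measure_pmf.prob ?M (- ?G) = 1 - measure_pmf.prob ?M ?G"
    using measure_pmf.prob_compl[of ?G ?M] by (simp add: Compl_eq_Diff_UNIV)
  moreover have "- ?G = {f. \<not> Digraph_Component.connected (with_proj (edge_graph n f))}" by auto
  ultimately show ?thesis
    using prob_disconnected_le[OF assms] by (simp add: gnp_def vimage_def)
qed

section \<open>Explicit bounds\<close>

text \<open>The value 33 is what \<open>1 + 32 / a \<le> real n\<close> guarantees for
  \<open>a \<le> 1\<close>.\<close>

lemma ln_ge_one_of_ge_33:
  assumes "33 \<le> real n"
  shows "1 \<le> ln (real n)"
proof -
  have "exp 1 \<le> real n" using exp_le assms by linarith
  then show ?thesis using assms by (simp add: ln_ge_iff)
qed

text \<open>The choice \<open>\<mu> = ln n\<close> makes each cap violation cost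
  \<open>n ^ - 3\<close>, and \<open>k \<le> n\<close> bounds their number. The main term is
  \<open>n ^ (- 2 + a / 32)\<close> by \<open>c\<close>, so the \<open>n ^ 2\<close> ordered pairs
  contribute \<open>n ^ (a / 32)\<close>, small against \<open>n ^ (a / 8)\<close>.\<close>

lemma expected_far_pairs_bound:
  fixes p d a :: real
  assumes a: "0 < a" "a \<le> 1" and n: "33 \<le> real n" and p: "0 \<le> p" "p \<le> 1" and k: "1 \<le> k"
    and d: "2 \<le> d" "d = p * (real n - 1)" "exp ((2 + 4 * ln (real n)) / d) \<le> 2" "d ^ k \<le> real n"
    and \<sigma>: "20 * p * d ^ (k - 1) \<le> a / 64" and c: "2 * ln (real n) \<le> p * d ^ k"
  shows "real n * measure_pmf.expectation (chain p (Suc k) 1 (n - 1)) (\<lambda>(t, u). real u)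
      / real n powr (a / 8) \<le> 2 * real n powr (- a / 16)"
proof -
  let ?E = "measure_pmf.expectation (chain p (Suc k) 1 (n - 1)) (\<lambda>(t, u). real u)"
  have ln: "1 \<le> ln (real n)" by (rule ln_ge_one_of_ge_33[OF n])
  have "real k \<le> 2 ^ k" using less_exp[of k] by (simp add: order_less_imp_le flip: of_nat_power)
  also have "\<dots> \<le> d ^ k" using d by (intro power_mono) auto
  finally have kn: "real k \<le> real n" using d by linarith
  have E: "?E \<le> real n * (exp (- p * d ^ k * (1 - 20 * p * d ^ (k - 1))) + real k * exp (- 3 * ln (real n)))"
    using d \<sigma> a ln p k by (intro expected_unreached_le) auto
  have "exp (- p * d ^ k * (1 - 20 * p * d ^ (k - 1))) \<le> real n powr (- 2 + a / 32)"
  proof -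
    have "2 * ln (real n) * (1 - a / 64) \<le> p * d ^ k * (1 - 20 * p * d ^ (k - 1))"
      using c \<sigma> a ln p d by (intro mult_mono[OF c]) auto
    then show ?thesis using n by (simp add: powr_def algebra_simps)
  qed
  moreover have "real k * exp (- 3 * ln (real n)) \<le> real n powr (- 2 + a / 32)"
  proof -
    have "real k * exp (- 3 * ln (real n)) \<le> real n powr 1 * real n powr (- 3)"
      using kn n by (intro mult_mono) (auto simp: powr_def)
    also have "\<dots> = real n powr (- 2)" unfolding powr_add[symmetric] by simp
    also have "\<dots> \<le> real n powr (- 2 + a / 32)" using n a by (intro powr_mono) auto
    finally show ?thesis .
  qed
  ultimately have "real n * (exp (- p * d ^ k * (1 - 20 * p * d ^ (k - 1))) + real k * exp (- 3 * ln (real n)))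
      \<le> real n * (2 * real n powr (- 2 + a / 32))"
    by (intro mult_left_mono) auto
  with E have "real n * ?E \<le> real n * (real n * (2 * real n powr (- 2 + a / 32)))"
    by (intro mult_left_mono) auto
  also have "\<dots> = 2 * (real n powr 1 * real n powr 1 * real n powr (- 2 + a / 32))"
    using n by simp
  also have "\<dots> = 2 * real n powr (a / 32)"
    unfolding powr_add[symmetric] by simp
  finally have "real n * ?E / real n powr (a / 8) \<le> 2 * real n powr (a / 32) / real n powr (a / 8)"
    by (intro divide_right_mono) auto
  also have "\<dots> = 2 * real n powr (a / 32 - a / 8)" unfolding powr_diff by simp
  also have "\<dots> \<le> 2 * real n powr (- a / 16)"
    using n a by (intro mult_left_mono powr_mono) auto
  finally show ?thesis .
qed

text \<open>Each of the two error terms, an oversized \<open>(k - 1)\<close>-ball and an unusually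
  effective last step, is at most \<open>n ^ - (r + 1)\<close>. The slack \<open>a / 2\<close> in
  the bound on \<open>r\<close> is split: half is spent on relative errors in the exponent, the
  other half leaves the surplus \<open>n ^ (a / 4)\<close> of missed vertices.\<close>

lemma few_unreached_bound:
  fixes p d a :: real
  assumes a: "0 < a" "a \<le> 1" and n: "1 + 32 / a \<le> real n" and p: "0 \<le> p" "p \<le> a / 64" and k: "1 \<le> k"
    and d: "8 * ln (real n) \<le> d" "d = p * (real n - 1)" "d ^ k \<le> real n"
    and \<mu>: "exp ((2 + 512 / a * ln (real n)) / d) \<le> 1 + a / 64"
    and r: "1 \<le> r" "real r \<le> (log (real n) (d ^ k) - a / 2) * (real n * ln (real n) / d ^ k)"
    and large: "(ln (real n))\<^sup>2 + real n powr (a / 8) + 2 + ln (real n) \<le> real n powr (a / 4) / 4"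
  shows "r \<le> n"
    and "measure_pmf.prob (chain p k r (n - r)) {(t, u). real u \<le> real n powr (a / 8) + 2}
      \<le> 2 * exp (- (real r + 1) * ln (real n))"
proof -
  define \<delta> where "\<delta> = a / 32"
  define D where "D = d ^ k"
  define \<eta> where "\<eta> = log (real n) D"
  define l where "l = ln (real n)"
  define B where "B = (1 + \<delta>) * real r * d ^ (k - 1)"
  have "32 \<le> 32 / a" using a by (simp add: field_simps)
  then have n33: "33 \<le> real n" using n by linarith
  have l: "1 \<le> l" unfolding l_def by (rule ln_ge_one_of_ge_33[OF n33])
  have d8: "8 \<le> d" using d(1) l by (simp add: l_def)
  have \<delta>: "0 < \<delta>" "\<delta> \<le> 1 / 32" using a by (auto simp: \<delta>_def)
  have D: "0 < D" "D \<le> real n" "d \<le> D" "1 \<le> D"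
    using d8 d(3) k self_le_power[of d k] by (auto simp: D_def)
  have \<eta>1: "\<eta> \<le> 1"
    using D n33 by (simp add: \<eta>_def log_le_one_cancel_iff)
  have nD: "1 \<le> real n / D" using D by simp
  have r_le: "real r \<le> (\<eta> - a / 2) * (real n * l / D)"
    using r(2) by (simp add: \<eta>_def D_def l_def)
  \<comment> \<open>As \<open>r\<close> is positive, so is its upper bound; this fixes the sign of
    \<open>\<eta> - a / 2\<close> for the monotonicity steps below.\<close>
  have "0 < real n * l / D" using D n33 l by simp
  moreover have "0 < real r" using r by simp
  ultimately have \<eta>a: "0 < \<eta> - a / 2"
    using r_le by (meson less_le_trans zero_less_mult_pos2)
  have "(\<eta> - a / 2) * (real n * l / D) \<le> 1 * (real n * l / D)"
    using \<eta>1 a D n33 l by (intro mult_right_mono) auto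
  then have rD: "real r \<le> real n / D * l" using r_le by simp
  also have "\<dots> \<le> real n / d * l" using D d8 l by (intro mult_right_mono divide_left_mono) auto
  also have "\<dots> \<le> real n / 8"
  proof -
    have "real n * (8 * l) \<le> real n * d" using d(1) by (intro mult_left_mono) (auto simp: l_def)
    then show ?thesis using d8 by (simp add: field_simps)
  qed
  finally have r8: "real r \<le> real n / 8" .
  then show rn: "r \<le> n" by simp
  have Dk: "D = d * d ^ (k - 1)" using k by (cases k) (auto simp: D_def)
  \<comment> \<open>Three factors \<open>1 + \<delta>\<close> accumulate: the excess size of the
    ball, \<open>n / (n - 1)\<close> and \<open>1 / (1 - p)\<close>. Their product is at most
    \<open>1 + 4 * \<delta> = 1 + a / 8\<close>, which fits between \<open>\<eta> - a / 2\<close>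
    and \<open>\<eta> - a / 4\<close>.\<close>
  have pB: "p * B / (1 - p) \<le> (\<eta> - a / 4) * l"
  proof -
    have p1: "1 / (1 - p) \<le> 1 + \<delta>"
    proof -
      have "(1 - p) * (1 + \<delta>) \<ge> (1 - \<delta> / 2) * (1 + \<delta>)"
        using p \<delta> by (intro mult_right_mono) (auto simp: \<delta>_def)
      moreover have "(1 - \<delta> / 2) * (1 + \<delta>) = 1 + \<delta> / 2 * (1 - \<delta>)" by (simp add: field_simps)
      moreover have "0 \<le> \<delta> / 2 * (1 - \<delta>)" using \<delta> by (intro mult_nonneg_nonneg) auto
      ultimately have "1 \<le> (1 - p) * (1 + \<delta>)" by linarith
      then show ?thesis using p a by (simp add: field_simps)
    qed
    have n1: "real n / (real n - 1) \<le> 1 + \<delta>"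
    proof -
      have "1 \<le> \<delta> * (real n - 1)" using n a by (simp add: \<delta>_def field_simps)
      then show ?thesis using n33 by (simp add: field_simps)
    qed
    have "p * d ^ (k - 1) = D / (real n - 1)"
      using d(2) n33 by (simp add: Dk)
    moreover have "p * B = (1 + \<delta>) * real r * (p * d ^ (k - 1))" by (simp add: B_def)
    ultimately have "p * B = (1 + \<delta>) * real r * D / (real n - 1)" by simp
    also have "\<dots> \<le> (1 + \<delta>) * ((\<eta> - a / 2) * (real n * l / D)) * D / (real n - 1)"
      using r_le \<delta> D n33 by (intro divide_right_mono mult_right_mono mult_left_mono) auto
    also have "\<dots> = (1 + \<delta>) * ((\<eta> - a / 2) * l) * (real n / (real n - 1))"
      using D by simp
    also have "\<dots> \<le> (1 + \<delta>) * ((\<eta> - a / 2) * l) * (1 + \<delta>)"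
      using n1 \<eta>a \<delta> l by (intro mult_left_mono) auto
    finally have "p * B \<le> (1 + \<delta>) * ((\<eta> - a / 2) * l) * (1 + \<delta>)" .
    from mult_mono[OF this p1]
    have "p * B * (1 / (1 - p)) \<le> (1 + \<delta>) * ((\<eta> - a / 2) * l) * (1 + \<delta>) * (1 + \<delta>)"
      using p a \<eta>a \<delta> l by simp
    also have "\<dots> = (1 + \<delta>) ^ 3 * (\<eta> - a / 2) * l" by (simp add: power3_eq_cube)
    also have "\<dots> \<le> (\<eta> - a / 4) * l"
    proof (rule mult_right_mono)
      have "\<delta> * \<delta> \<le> \<delta> * (1 / 32)" using \<delta> by (intro mult_left_mono) auto
      moreover have "\<delta> * (\<delta> * \<delta>) \<le> \<delta> * (\<delta> * 1)" using \<delta> by (intro mult_left_mono) auto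
      moreover have "(1 + \<delta>) ^ 3 = 1 + 3 * \<delta> + 3 * (\<delta> * \<delta>) + \<delta> * (\<delta> * \<delta>)"
        by (simp add: power3_eq_cube algebra_simps)
      ultimately have "(1 + \<delta>) ^ 3 \<le> 1 + 4 * \<delta>" using \<delta> by linarith
      then have "(1 + \<delta>) ^ 3 * (\<eta> - a / 2) \<le> (1 + 4 * \<delta>) * (\<eta> - a / 2)"
        using \<eta>a by (intro mult_right_mono) auto
      also have "\<dots> = (\<eta> - a / 2) + 4 * \<delta> * (\<eta> - a / 2)" by (simp add: algebra_simps)
      also have "\<dots> \<le> (\<eta> - a / 2) + 4 * \<delta> * 1"
        using \<eta>1 a \<delta> by (intro add_left_mono mult_left_mono) auto
      also have "\<dots> \<le> \<eta> - a / 4" using a by (simp add: \<delta>_def)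
      finally show "(1 + \<delta>) ^ 3 * (\<eta> - a / 2) \<le> \<eta> - a / 4" .
    qed (use l in simp)
    finally show ?thesis by simp
  qed
  have B0: "0 \<le> B" using \<delta> d8 by (simp add: B_def)
  have B_le: "B \<le> real n / 2"
  proof -
    have "real r * D \<le> real n * l" using rD D by (simp add: field_simps)
    moreover have "B * d = (1 + \<delta>) * (real r * D)" by (simp add: B_def Dk mult_ac)
    ultimately have "B * d \<le> (1 + \<delta>) * (real n * l)" using \<delta> by (simp add: mult_left_mono)
    also have "\<dots> \<le> 2 * (real n * l)" using \<delta> l n33 by (intro mult_right_mono) auto
    also have "\<dots> \<le> real n / 2 * d"
    proof -
      have "real n * (8 * l) \<le> real n * d" using d(1) by (intro mult_left_mono) (auto simp: l_def)
      then show ?thesis using n33 l by simp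
    qed
    finally show ?thesis using d8 by simp
  qed
  have powr_eta: "real n powr \<eta> = D" using n33 D by (simp add: \<eta>_def)
  have exp_ge: "real n powr (a / 4) / D \<le> exp (- p * B / (1 - p))"
  proof -
    have "real n powr (a / 4) / D = real n powr (a / 4 - \<eta>)"
      by (simp add: powr_diff powr_eta)
    also have "\<dots> = exp (- ((\<eta> - a / 4) * l))"
      using n33 by (simp add: powr_def l_def algebra_simps)
    also have "\<dots> \<le> exp (- p * B / (1 - p))" using pB by simp
    finally show ?thesis .
  qed
  \<comment> \<open>The inequality \<open>large\<close> is multiplied by
    \<open>n / D \<ge> 1\<close>. Its square of the logarithm then dominates \<open>r * l\<close>,
    since \<open>r \<le> n / D * l\<close>.\<close>
  have cover: "exp (real n powr (a / 8) + 2 - (real n - B) * exp (- p * B / (1 - p)) / 2)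
      \<le> exp (- (real r + 1) * l)"
  proof -
    have "real n / 2 * (real n powr (a / 4) / D) \<le> (real n - B) * exp (- p * B / (1 - p))"
      using B_le exp_ge D by (intro mult_mono) auto
    then have 1: "real n / D * (real n powr (a / 4) / 4) \<le> (real n - B) * exp (- p * B / (1 - p)) / 2"
      by simp
    have "real n / D * (l\<^sup>2 + real n powr (a / 8) + 2 + l) \<le> real n / D * (real n powr (a / 4) / 4)"
      using large D by (intro mult_left_mono) (auto simp: l_def)
    moreover have "1 * (real n powr (a / 8) + 2 + l) \<le> real n / D * (real n powr (a / 8) + 2 + l)"
      using nD l by (intro mult_right_mono) auto
    moreover have "real r * l \<le> real n / D * l * l" using rD l by (intro mult_right_mono) auto
    ultimately have "real r * l + real n powr (a / 8) + 2 + l \<le> real n / D * (real n powr (a / 4) / 4)"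
      by (simp add: distrib_left power2_eq_square)
    with 1 show ?thesis by (simp add: algebra_simps)
  qed
  have tail: "measure_pmf.prob (chain p (k - 1) r (n - r))
      {(t, u). B < real r + real (n - r) - real u} \<le> exp (- (real r + 1) * l)"
  proof -
    \<comment> \<open>The factor 128 is chosen so that \<open>\<mu> * \<delta> / 2 = 2 * l\<close>:
      the tail becomes \<open>exp (- 2 * r * l)\<close>, and \<open>r \<ge> 1\<close> turns this
      into \<open>exp (- (r + 1) * l)\<close>. Four times 128 is the 512 of the hypothesis.\<close>
    let ?\<mu> = "128 / a * l"
    have \<mu>': "exp ((2 + 4 * ?\<mu>) / d) \<le> 1 + \<delta> / 2" using \<mu> by (simp add: \<delta>_def l_def)
    have "p * real (n - r) \<le> d"
      unfolding d(2) using r p rn by (intro mult_left_mono) (auto simp: of_nat_diff)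
    then have "measure_pmf.prob (chain p (k - 1) r (n - r))
        {(t, u). (1 + \<delta>) * real r * d ^ (k - 1) < real r + real (n - r) - real u}
      \<le> exp (?\<mu> * (real r * exp ((2 + 4 * ?\<mu>) / d) - (1 + \<delta>) * real r))"
      using p a d8 l \<mu>' \<delta> by (intro chain_growth_tail) auto
    also have "\<dots> \<le> exp (- (real r + 1) * l)"
    proof -
      have "real r * exp ((2 + 4 * ?\<mu>) / d) \<le> real r * (1 + \<delta> / 2)"
        using \<mu>' by (intro mult_left_mono) auto
      then have "?\<mu> * (real r * exp ((2 + 4 * ?\<mu>) / d) - (1 + \<delta>) * real r)
          \<le> ?\<mu> * (- (\<delta> / 2 * real r))"
        using a l by (intro mult_left_mono) (auto simp: algebra_simps)
      also have "\<dots> = - (2 * real r * l)" using a by (simp add: \<delta>_def)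
      also have "\<dots> \<le> - (real r + 1) * l" using r l by (simp add: algebra_simps)
      finally show ?thesis by simp
    qed
    finally show ?thesis by (simp add: B_def)
  qed
  have "measure_pmf.prob (chain p (Suc (k - 1)) r (n - r)) {(t, u). real u \<le> real n powr (a / 8) + 2}
      \<le> measure_pmf.prob (chain p (k - 1) r (n - r)) {(t, u). B < real r + real (n - r) - real u}
        + exp (real n powr (a / 8) + 2
            - (real r + real (n - r) - B) * exp (- p * B / (1 - p)) / 2)"
    using p a B0 B_le rn by (intro prob_few_unreached_le) (auto simp: of_nat_diff)
  also have "\<dots> \<le> exp (- (real r + 1) * l) + exp (- (real r + 1) * l)"
    using tail cover rn by (intro add_mono) (auto simp: of_nat_diff)
  finally show "measure_pmf.prob (chain p k r (n - r)) {(t, u). real u \<le> real n powr (a / 8) + 2}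
      \<le> 2 * exp (- (real r + 1) * ln (real n))"
    using k by (simp add: l_def)
qed

lemma disconnected_prob_bound:
  fixes p :: real
  assumes n: "33 \<le> real n" and p: "0 \<le> p" "8 * ln (real n) \<le> p * (real n - 1)"
  shows "(real n)\<^sup>2 * exp (- p * real n / 2) \<le> 1 / real n"
proof -
  have l: "1 \<le> ln (real n)" by (rule ln_ge_one_of_ge_33[OF n])
  have exp_ln: "exp (- ln (real n)) = 1 / real n" using n by (simp add: exp_minus field_simps)
  have "3 * ln (real n) \<le> p * real n / 2" using p l by (simp add: algebra_simps)
  then have "exp (- p * real n / 2) \<le> exp (- ln (real n) + - ln (real n) + - ln (real n))" by simp
  also have "\<dots> = 1 / real n * (1 / real n) * (1 / real n)" unfolding exp_add exp_ln ..
  finally have "(real n)\<^sup>2 * exp (- p * real n / 2) \<le> (real n)\<^sup>2 * (1 / real n * (1 / real n) * (1 / real n))"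
    by (intro mult_left_mono) auto
  then show ?thesis using n by (simp add: power2_eq_square)
qed

lemma gnp_metric_dim_gt_finite:
  fixes p d a :: real
  assumes a: "0 < a" "a \<le> 1" and n: "1 + 32 / a \<le> real n" and p: "0 \<le> p" "p \<le> a / 64" and k: "1 \<le> k"
    and d: "8 * ln (real n) \<le> d" "d = p * (real n - 1)" "d ^ k \<le> real n"
    and \<mu>: "exp ((2 + 512 / a * ln (real n)) / d) \<le> 1 + a / 64"
    and \<sigma>: "20 * p * d ^ (k - 1) \<le> a / 64" and c: "2 * ln (real n) \<le> p * d ^ k"
    and r: "1 \<le> r" "real r \<le> (log (real n) (d ^ k) - a / 2) * (real n * ln (real n) / d ^ k)"
    and large: "(ln (real n))\<^sup>2 + real n powr (a / 8) + 2 + ln (real n) \<le> real n powr (a / 4) / 4"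
  shows "1 - (1 / real n + 2 * real n powr (- a / 16) + 2 / real n) \<le> measure_pmf.prob (gnp n p)
    {G. Digraph_Component.connected (with_proj G) \<and> r < metric_dim (with_proj G)}"
proof -
  have "32 \<le> 32 / a" using a by (simp add: field_simps)
  then have n33: "33 \<le> real n" using n by linarith
  have l: "1 \<le> ln (real n)" by (rule ln_ge_one_of_ge_33[OF n33])
  have exp_ln: "exp (- ln (real n)) = 1 / real n" using n33 by (simp add: exp_minus field_simps)
  have conn: "(real n)\<^sup>2 * exp (- p * real n / 2) \<le> 1 / real n"
    using d(1,2) p n33 by (intro disconnected_prob_bound) auto
  have far: "real n * measure_pmf.expectation (chain p (Suc k) 1 (n - 1)) (\<lambda>(t, u). real u)
      / real n powr (a / 8) \<le> 2 * real n powr (- a / 16)"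
  proof (rule expected_far_pairs_bound[OF a n33 p(1) _ k _ d(2) _ d(3) \<sigma> c])
    \<comment> \<open>The hypothesis on \<open>exp\<close> is calibrated to the growth of balls
      around \<open>R\<close>; the milder exponent \<open>ln n\<close> needed for a single vertex
      follows by monotonicity.\<close>
    have "4 \<le> 512 / a" using a by (simp add: field_simps)
    then have "4 * ln (real n) \<le> 512 / a * ln (real n)" using l by (intro mult_right_mono) auto
    then have "(2 + 4 * ln (real n)) / d \<le> (2 + 512 / a * ln (real n)) / d"
      using d(1) l by (intro divide_right_mono) auto
    then have "exp ((2 + 4 * ln (real n)) / d) \<le> 1 + a / 64"
      using \<mu> by (meson exp_le_cancel_iff order_trans)
    then show "exp ((2 + 4 * ln (real n)) / d) \<le> 2" using a by simp
  qed (use p a d(1) l in auto)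
  have b: "real n ^ r * (2 * exp (- (real r + 1) * ln (real n))) = 2 / real n"
  proof -
    have "exp (- (real r + 1) * ln (real n)) = exp (- ln (real n)) ^ Suc r"
      by (simp only: exp_of_nat_mult[symmetric]) (simp add: algebra_simps)
    then show ?thesis unfolding exp_ln using n33 by (simp add: power_divide)
  qed
  have "1 - (1 / real n + 2 * real n powr (- a / 16)
      + real n ^ r * (2 * exp (- (real r + 1) * ln (real n)))) \<le> measure_pmf.prob (gnp n p)
    {G. Digraph_Component.connected (with_proj G) \<and> r < metric_dim (with_proj G)}"
    using few_unreached_bound[OF a n p k d \<mu> r large] p a n33
    by (intro gnp_metric_dim_gt[OF _ p(1) _ _ _ _ conn far]) auto
  then show ?thesis unfolding b .
qed

section \<open>Asymptotics\<close>

text \<open>For each \<open>n\<close> the finest accuracy \<open>1 / (k + 1)\<close>,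
  \<open>k \<le> n\<close>, that is already achieved at \<open>n\<close> is selected. Every fixed
  accuracy is achieved eventually, so the selected one tends to 0.\<close>

lemma tendsto_diagonal:
  fixes Q :: "real \<Rightarrow> nat \<Rightarrow> real"
  assumes lim: "\<And>a. 0 < a \<Longrightarrow> a \<le> 1 \<Longrightarrow> Q a \<longlonglongrightarrow> 1"
  shows "\<exists>e. e \<longlonglongrightarrow> 0 \<and> (\<lambda>n. Q (e n) n) \<longlonglongrightarrow> 1"
proof -
  define P where "P k n \<longleftrightarrow> \<bar>Q (inverse (real (Suc k))) n - 1\<bar> \<le> inverse (real (Suc k))" for k n
  \<comment> \<open>The inserted 0 keeps the maximum defined when no accuracy is achieved, and
    \<open>k \<le> n\<close> keeps the set finite. Once \<open>K n \<ge> 1\<close> the maximum is a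
    genuine member.\<close>
  define K where "K n = Max (insert 0 {k. k \<le> n \<and> P k n})" for n
  define e where "e n = inverse (real (Suc (K n)))" for n
  have K_ge: "eventually (\<lambda>n. k \<le> K n) sequentially" for k
  proof -
    have "Q (inverse (real (Suc k))) \<longlonglongrightarrow> 1"
      by (rule lim) (auto simp: inverse_le_1_iff)
    then have "eventually (\<lambda>n. dist (Q (inverse (real (Suc k))) n) 1 < inverse (real (Suc k))) sequentially"
      by (rule tendstoD) simp
    with eventually_ge_at_top[of k] show ?thesis
    proof eventually_elim
      case (elim n)
      then have "k \<in> insert 0 {k. k \<le> n \<and> P k n}" by (auto simp: P_def dist_real_def)
      then show ?case unfolding K_def by (intro Max_ge) auto
    qed
  qed
  have "filterlim K at_top sequentially"
    unfolding filterlim_at_top using K_ge by blast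
  then have e0: "e \<longlonglongrightarrow> 0"
    unfolding e_def by (rule filterlim_compose[OF LIMSEQ_inverse_real_of_nat])
  have "eventually (\<lambda>n. norm (Q (e n) n - 1) \<le> e n) sequentially"
    using K_ge[of 1]
  proof eventually_elim
    case (elim n)
    have "K n \<in> insert 0 {k. k \<le> n \<and> P k n}" unfolding K_def by (rule Max_in) auto
    then have "P (K n) n" using elim by auto
    then show ?case by (simp add: P_def e_def)
  qed
  then have "(\<lambda>n. Q (e n) n - 1) \<longlonglongrightarrow> 0"
    by (rule Lim_null_comparison[OF _ e0])
  then have "(\<lambda>n. Q (e n) n) \<longlonglongrightarrow> 1" by (rule LIM_zero_cancel)
  with e0 show ?thesis by blast
qed

text \<open>Rounding \<open>r\<close> up costs at most 1, which half of \<open>a\<close> absorbs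
  because \<open>a / 2 * N \<ge> 1\<close>. If \<open>\<eta> \<le> a\<close>, the lower bound is
  nonpositive and only connectivity remains to be shown.\<close>

lemma gnp_metric_dim_ge_finite:
  fixes p d a :: real
  assumes a: "0 < a" "a \<le> 1" and n: "1 + 32 / a \<le> real n" and p: "0 \<le> p" "p \<le> a / 64" and k: "1 \<le> k"
    and d: "8 * ln (real n) \<le> d" "d = p * (real n - 1)" "d ^ k \<le> real n"
    and \<mu>: "exp ((2 + 512 / a * ln (real n)) / d) \<le> 1 + a / 64"
    and \<sigma>: "20 * p * d ^ (k - 1) \<le> a / 64" and c: "2 * ln (real n) \<le> p * d ^ k"
    and large: "(ln (real n))\<^sup>2 + real n powr (a / 8) + 2 + ln (real n) \<le> real n powr (a / 4) / 4"
    and ln: "2 / a \<le> ln (real n)"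
  shows "1 - (1 / real n + 2 * real n powr (- a / 16) + 2 / real n) \<le> measure_pmf.prob (gnp n p)
    {G. Digraph_Component.connected (with_proj G) \<and>
        real (metric_dim (with_proj G))
          \<ge> (log (real n) (d ^ k) - a) * (real n * ln (real n) / d ^ k)}"
proof -
  define N where "N = real n * ln (real n) / d ^ k"
  define \<eta> where "\<eta> = log (real n) (d ^ k)"
  have "32 \<le> 32 / a" using a by (simp add: field_simps)
  then have n33: "33 \<le> real n" using n by linarith
  have l: "1 \<le> ln (real n)" by (rule ln_ge_one_of_ge_33[OF n33])
  have D: "0 < d ^ k" using d(1) l by simp
  have "1 * ln (real n) \<le> real n / d ^ k * ln (real n)"
    using D d(3) l by (intro mult_right_mono) auto
  then have N: "2 / a \<le> N" using ln by (simp add: N_def)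
  have "0 < 2 / a" using a by simp
  then have N0: "0 < N" using N by linarith
  let ?G = "{G. Digraph_Component.connected (with_proj G) \<and>
      (\<eta> - a) * N \<le> real (metric_dim (with_proj G))}"
  have "1 - (1 / real n + 2 * real n powr (- a / 16) + 2 / real n) \<le> measure_pmf.prob (gnp n p) ?G"
  proof (cases "a < \<eta>")
    case True
    define r where "r = nat \<lceil>(\<eta> - a) * N\<rceil>"
    have pos: "0 < (\<eta> - a) * N" by (rule mult_pos_pos) (use True N0 in auto)
    then have r: "1 \<le> r" "(\<eta> - a) * N \<le> real r" "real r \<le> (\<eta> - a) * N + 1"
      unfolding r_def by linarith+
    have "a / 2 * (2 / a) \<le> a / 2 * N" using N a by (intro mult_left_mono) auto
    then have "1 \<le> a / 2 * N" using a by simp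
    moreover have "(\<eta> - a / 2) * N = (\<eta> - a) * N + a / 2 * N" by (simp add: algebra_simps)
    ultimately have "real r \<le> (\<eta> - a / 2) * N" using r(3) by linarith
    then have "1 - (1 / real n + 2 * real n powr (- a / 16) + 2 / real n) \<le> measure_pmf.prob (gnp n p)
        {G. Digraph_Component.connected (with_proj G) \<and> r < metric_dim (with_proj G)}"
      unfolding N_def \<eta>_def by (rule gnp_metric_dim_gt_finite[OF a n p k d \<mu> \<sigma> c r(1) _ large])
    also have "\<dots> \<le> measure_pmf.prob (gnp n p) ?G"
    proof (rule measure_pmf.finite_measure_mono)
      have "(\<eta> - a) * N \<le> real m" if "r < m" for m using that r(2) by linarith
      then show "{G. Digraph_Component.connected (with_proj G) \<and> r < metric_dim (with_proj G)} \<subseteq> ?G"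
        by blast
    qed simp
    finally show ?thesis .
  next
    case False
    have "(\<eta> - a) * N \<le> 0" by (rule mult_nonpos_nonneg) (use False N0 in auto)
    then have "(\<eta> - a) * N \<le> real m" for m by (meson of_nat_0_le_iff order_trans)
    then have G: "?G = {G. Digraph_Component.connected (with_proj G)}" by blast
    have "1 - 1 / real n \<le> 1 - (real n)\<^sup>2 * exp (- p * real n / 2)"
      using disconnected_prob_bound[OF n33 p(1)] d(1,2) by linarith
    also have "\<dots> \<le> measure_pmf.prob (gnp n p) ?G"
      unfolding G by (rule gnp_connected_prob) (use n33 p a in auto)
    finally have "1 - 1 / real n \<le> measure_pmf.prob (gnp n p) ?G" .
    moreover have "0 \<le> 2 * real n powr (- a / 16) + 2 / real n" by simp
    ultimately show ?thesis by linarith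
  qed
  then show ?thesis by (simp add: N_def \<eta>_def)
qed

theorem theorem4p3:
  fixes p d c \<eta> :: "nat \<Rightarrow> real" and i :: "nat \<Rightarrow> nat"
  assumes p_prob: "\<And>n. 0 \<le> p n \<and> p n \<le> 1"
    and d_eq: "\<And>n. d n = p n * (real n - 1)"
    and log_small: "(\<lambda>n. ln (real n)) \<in> o(d)"
    and d_small: "d \<in> o(\<lambda>n. real n)"
    and i_pos: "\<And>n. i n \<ge> 1"
    and i_admissible: "(\<lambda>n. d n ^ i n) \<in> o(\<lambda>n. real n)"
    and i_largest: "\<And>j :: nat \<Rightarrow> nat. (\<lambda>n. d n ^ j n) \<in> o(\<lambda>n. real n) \<Longrightarrow>
                      eventually (\<lambda>n. j n \<le> i n) sequentially"
    and c_eq: "\<And>n. c n = d n ^ (i n + 1) / real n"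
    and eta_eq: "\<And>n. \<eta> n = log (real n) (d n ^ i n)"
    and c_large: "filterlim (\<lambda>n. c n - 2 * ln (real n)) at_top sequentially"
  shows "\<exists>\<epsilon> :: nat \<Rightarrow> real. \<epsilon> \<longlonglongrightarrow> 0 \<and>
    (\<lambda>n. measure_pmf.prob (gnp n (p n))
           {G. Digraph_Component.connected (with_proj G) \<and>
               real (metric_dim (with_proj G))
                 \<ge> (\<eta> n + \<epsilon> n) * (real n * ln (real n) / d n ^ i n)}) \<longlonglongrightarrow> 1"
proof -
  define Q where "Q a n = measure_pmf.prob (gnp n (p n))
      {G. Digraph_Component.connected (with_proj G) \<and>
          real (metric_dim (with_proj G)) \<ge> (\<eta> n - a) * (real n * ln (real n) / d n ^ i n)}"
    for a n
  have "Q a \<longlonglongrightarrow> 1" if a: "0 < a" "a \<le> 1" for a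
  proof (rule tendsto_sandwich)
    \<comment> \<open>With \<open>d \<ge> K * ln n\<close> and \<open>ln n \<ge> 1\<close>, the
      first argument of the maximum gives \<open>8 * ln n \<le> d\<close> and the second the
      condition on \<open>exp\<close>.\<close>
    define K where "K = max 8 ((2 + 512 / a) / ln (1 + a / 64))"
    have ln_pos: "0 < ln (1 + a / 64)" using a by simp
    have K: "8 \<le> K" "2 + 512 / a \<le> K * ln (1 + a / 64)"
      using ln_pos by (auto simp: K_def pos_divide_le_eq[symmetric])
    have ev_d: "eventually (\<lambda>n. norm (ln (real n)) \<le> 1 / K * norm (d n)) sequentially"
      using landau_o.smallD[OF log_small, of "1 / K"] K by simp
    \<comment> \<open>The constants 128 and 2560 are \<open>2 * 64\<close> and
      \<open>20 * 2 * 64\<close>; the factor 2 comes from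
      \<open>1 / (n - 1) \<le> 2 / n\<close>.\<close>
    have ev_p: "eventually (\<lambda>n. norm (d n) \<le> a / 128 * norm (real n)) sequentially"
      using landau_o.smallD[OF d_small, of "a / 128"] a by simp
    have ev_D: "eventually (\<lambda>n. norm (d n ^ i n) \<le> a / 2560 * norm (real n)) sequentially"
      using landau_o.smallD[OF i_admissible, of "a / 2560"] a by simp
    have ev_c: "eventually (\<lambda>n. 0 \<le> c n - 2 * ln (real n)) sequentially"
      using c_large unfolding filterlim_at_top by blast
    have ev_large: "eventually (\<lambda>n. (ln (real n))\<^sup>2 + real n powr (a / 8) + 2 + ln (real n)
        \<le> real n powr (a / 4) / 4) sequentially"
      using a(1) by real_asymp
    have ev_n: "eventually (\<lambda>n. 1 + 32 / a \<le> real n) sequentially" by real_asymp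
    have ev_ln: "eventually (\<lambda>n. 2 / a \<le> ln (real n)) sequentially" by real_asymp
    show "eventually (\<lambda>n. 1 - (1 / real n + 2 * real n powr (- a / 16) + 2 / real n) \<le> Q a n)
        sequentially"
      using ev_d ev_p ev_D ev_c ev_large ev_n ev_ln
    proof eventually_elim
      case (elim n)
      have "32 \<le> 32 / a" using a by (simp add: field_simps)
      then have n33: "33 \<le> real n" using elim(6) by linarith
      have l: "1 \<le> ln (real n)" by (rule ln_ge_one_of_ge_33[OF n33])
      have p: "0 \<le> p n" using p_prob by simp
      have d0: "0 \<le> d n" unfolding d_eq using p n33 by (intro mult_nonneg_nonneg) auto
      have Kd: "K * ln (real n) \<le> d n" using elim(1) l d0 K by (simp add: field_simps)
      have "8 * ln (real n) \<le> K * ln (real n)" using K l by (intro mult_right_mono) auto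
      then have d8: "8 * ln (real n) \<le> d n" using Kd by linarith
      have d_pos: "0 < d n" using d8 l by linarith
      have pn: "p n = d n / (real n - 1)" using n33 by (simp add: d_eq)
      have n2: "1 / (real n - 1) \<le> 2 / real n" using n33 by (simp add: field_simps)
      have p_le: "p n \<le> a / 64"
      proof -
        have "p n \<le> d n * (2 / real n)"
          unfolding pn using mult_left_mono[OF n2 d0] by simp
        also have "\<dots> \<le> a / 64" using elim(2) d0 n33 by (simp add: field_simps)
        finally show ?thesis .
      qed
      have D: "d n ^ i n \<le> a / 2560 * real n" using elim(3) d0 by simp
      also have "\<dots> \<le> 1 * real n" using a by (intro mult_right_mono) auto
      finally have D_le: "d n ^ i n \<le> real n" by simp
      have \<mu>: "exp ((2 + 512 / a * ln (real n)) / d n) \<le> 1 + a / 64"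
      proof -
        have "2 + 512 / a * ln (real n) \<le> (2 + 512 / a) * ln (real n)"
          using l a by (simp add: algebra_simps)
        also have "\<dots> \<le> K * ln (1 + a / 64) * ln (real n)"
          using K l by (intro mult_right_mono) auto
        also have "\<dots> = ln (1 + a / 64) * (K * ln (real n))" by simp
        also have "\<dots> \<le> ln (1 + a / 64) * d n" using Kd ln_pos by (intro mult_left_mono) auto
        finally have "(2 + 512 / a * ln (real n)) / d n \<le> ln (1 + a / 64)"
          using d_pos by (simp add: field_simps)
        then have "exp ((2 + 512 / a * ln (real n)) / d n) \<le> exp (ln (1 + a / 64))" by simp
        then show ?thesis using a by simp
      qed
      have d_Suc: "d n * d n ^ (i n - 1) = d n ^ i n" using i_pos[of n] by (cases "i n") auto
      have \<sigma>: "20 * p n * d n ^ (i n - 1) \<le> a / 64"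
      proof -
        have "20 * p n * d n ^ (i n - 1) = 20 * d n ^ i n * (1 / (real n - 1))"
          unfolding pn d_Suc[symmetric] by simp
        also have "\<dots> \<le> 20 * d n ^ i n * (2 / real n)"
          using d0 by (intro mult_left_mono n2) auto
        also have "\<dots> \<le> a / 64" using D n33 by (simp add: field_simps)
        finally show ?thesis .
      qed
      \<comment> \<open>As \<open>p = d / (n - 1)\<close>, the exponent \<open>p * d ^ i\<close> is
        at least \<open>c = d ^ (i + 1) / n\<close>.\<close>
      have c: "2 * ln (real n) \<le> p n * d n ^ i n"
      proof -
        have "2 * ln (real n) \<le> c n" using elim(4) by simp
        also have "\<dots> = d n * d n ^ i n / real n" by (simp add: c_eq)
        also have "\<dots> \<le> d n * d n ^ i n / (real n - 1)"
          using d0 n33 by (intro divide_left_mono) auto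
        finally show ?thesis by (simp add: pn)
      qed
      show ?case
        unfolding Q_def eta_eq
        by (rule gnp_metric_dim_ge_finite[OF a elim(6) p p_le i_pos d8 d_eq D_le \<mu> \<sigma> c elim(5,7)])
    qed
    show "eventually (\<lambda>n. Q a n \<le> 1) sequentially" by (simp add: Q_def)
    show "(\<lambda>n. 1 - (1 / real n + 2 * real n powr (- a / 16) + 2 / real n)) \<longlonglongrightarrow> 1"
    proof -
      have "(\<lambda>n. real n powr (- a / 16)) \<longlonglongrightarrow> 0"
        using a by (intro tendsto_neg_powr filterlim_real_sequentially) auto
      from tendsto_mult_left[OF this, of 2]
      have powr: "(\<lambda>n. 2 * real n powr (- a / 16)) \<longlonglongrightarrow> 0" by simp
      have inv: "(\<lambda>n. 1 / real n) \<longlonglongrightarrow> 0" "(\<lambda>n. 2 / real n) \<longlonglongrightarrow> 0" by real_asymp+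
      from tendsto_diff[OF tendsto_const[of 1] tendsto_add[OF tendsto_add[OF inv(1) powr] inv(2)]]
      show ?thesis by simp
    qed
  qed simp
  then have "\<exists>e. e \<longlonglongrightarrow> 0 \<and> (\<lambda>n. Q (e n) n) \<longlonglongrightarrow> 1"
    by (rule tendsto_diagonal)
  then obtain e where e: "e \<longlonglongrightarrow> 0" "(\<lambda>n. Q (e n) n) \<longlonglongrightarrow> 1"
    by (elim exE conjE) (rule that)
  from tendsto_minus[OF e(1)] have "(\<lambda>n. - e n) \<longlonglongrightarrow> 0"
    by (simp only: minus_zero)
  moreover have "(\<lambda>n. measure_pmf.prob (gnp n (p n))
      {G. Digraph_Component.connected (with_proj G) \<and>
          real (metric_dim (with_proj G))
            \<ge> (\<eta> n + - e n) * (real n * ln (real n) / d n ^ i n)}) \<longlonglongrightarrow> 1"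
    using e(2) unfolding Q_def diff_conv_add_uminus .
  ultimately show ?thesis by (rule exI[of _ "\<lambda>n. - e n", OF conjI])
qed

end
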